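(* Fix integers $l_1,l_2\geq 0$ and reals $\epsilon_1,\epsilon_2>0$. There exists $M(\epsilon_1,\epsilon_2)>0$ such that for all $g>M(\epsilon_1,\epsilon_2)$ and all pairs of subsets \[C,C'\subseteq \big[1,(\gamma-\epsilon_1)g\big) \cup \big((\gamma+\epsilon_1)g,(2\gamma-\epsilon_1)g\big) \cup \big((2\gamma+\epsilon_1)g,2g\big]\] (subsets of integers) with $|C|=l_1$, $|C'|=l_2$ and $C\cap C'=\emptyset$, we have \[\left|\mathbb{P}_g[C\subseteq S \text{ and } C'\cap S=\emptyset]-\prod_{n\in C}f_{1}\left(\frac{n}{g}\right)\prod_{n\in C'}\left(1-f_{1}\left(\frac{n}{g}\right)\right)\right|<\epsilon_2.\]
   Context: A numerical semigroup is a submonoid of $\mathbb{N}_0$ with finite complement; its genus is the size of the complement. $\mathcal{S}_g$ is the set of numerical semigroups of genus $g$ and $\mathbb{P}_g$ is the uniform probability on $\mathcal{S}_g$, $S$ denoting a random element. Let $\gamma=\frac{5+\sqrt5}{10}$ and define $f_1:[0,2]\setminus\{\gamma,2\gamma\}\to[0,1]$ by $f_1(x)=0$ if $0\le x<\gamma$, $f_1(x)=\frac{\sqrt5-1}{2}$ if $\gamma<x<2\gamma$, and $f_1(x)=1$ if $2\gamma<x\le 2$. *)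

theory Defs
  imports Complex_Main
begin

definition numerical_semigroup :: "nat set \<Rightarrow> bool" where
  "numerical_semigroup S \<longleftrightarrow>
     0 \<in> S \<and> (\<forall>a\<in>S. \<forall>b\<in>S. a + b \<in> S) \<and> finite (UNIV - S)"

definition genus :: "nat set \<Rightarrow> nat" where
  "genus S = card (UNIV - S)"

definition semigroups_of_genus :: "nat \<Rightarrow> nat set set" where
  "semigroups_of_genus g = {S. numerical_semigroup S \<and> genus S = g}"

definition prob_g :: "nat \<Rightarrow> (nat set \<Rightarrow> bool) \<Rightarrow> real" where
  "prob_g g P = real (card {S \<in> semigroups_of_genus g. P S}) / real (card (semigroups_of_genus g))"

definition gamma :: real where
  "gamma = (5 + sqrt 5) / 10"

text \<open>f_1; its values at gamma and 2 gamma are irrelevant (never used).\<close>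
definition f1 :: "real \<Rightarrow> real" where
  "f1 x = (if x < gamma then 0 else if x < 2 * gamma then (sqrt 5 - 1) / 2 else 1)"

definition admissible :: "real \<Rightarrow> nat \<Rightarrow> nat set" where
  "admissible e g = {n::nat. (1 \<le> real n \<and> real n < (gamma - e) * real g)
      \<or> ((gamma + e) * real g < real n \<and> real n < (2 * gamma - e) * real g)
      \<or> ((2 * gamma + e) * real g < real n \<and> real n \<le> 2 * real g)}"

end

theory Submission
imports Defs "HOL-Library.FuncSet" "HOL-Number_Theory.Fib"
begin

text \<open>
  Let m be the multiplicity and F the Frobenius number of S, and let k(c), for 0 < c < m, be the number
  of gaps of S congruent to c modulo m (the Kunz word), so that the genus is the sum of the k(c).
  Put tau = 1/phi, so that tau + tau^2 = 1, and give S the weight tau^genus.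

  If F is at most 2m + d, then S can be changed arbitrarily inside the interval (m + d, 2m) and stays
  a semigroup. Given everything outside this interval, a random S of genus g is therefore a
  uniformly random subset of prescribed size there, and finitely many prescribed positions become
  independent in the limit. The density is tau once m is close to gamma g, which holds up to an
  exponentially small proportion: in the bound x^(-g) (x + x^2)^m for the number of such S the
  optimal x moves away from tau as soon as m/g moves away from gamma.

  It remains to see that F > 2m + d is exponentially unlikely in d. Write F = (K-1)m + r, so that k(r) = K.
  Then k(c) + k(r-c) is at least K for c < r, and k(c) + k(m+r-c) is at least K-1 for c > r. These
  constraints alone suffice for K > 5. For smaller K one also uses the least y with k(y) = 1: a letter
  1 at c forbids letters above 2 at c + y. Reading the reflected pairs along the progressions
  c, c + y, c + 2y, ... gives a transfer matrix whose spectral radius is less than 1.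
\<close>

text \<open>Weighted counts suffice because of a lower bound for the denominator: the semigroups
  that contain every number above 2m are already at least as many as a Fibonacci number, so the
  total weight at genus g never drops below tau. A family is negligible once its weight tends to 0,
  and polynomially many types (m, K, r, y) are harmless against exponential decay.

  The obstacle is that tau is critical. The letters 1 and 2 have total weight tau + tau^2 = 1, so
  for K = 3 the segment beyond r gives no decay; only r = F - 2m is left to decay in, hence the
  threshold 2m + d. Reflected pairs with letters up to s and sum at least s have total weight about
  1.146 for s = 3, 1.056 for s = 4 and 0.875 for s = 5. The segments have s = K and s = K - 1, so
  pairs alone contract both of them only if K > 5; otherwise the shift y must help.

  The length d is eta g: linear in g so that 0.998^d beats polynomials, with eta small because the
  windows of length d after m and 2m cost a factor 4^d against the gain away from gamma.\<close>

section \<open>Sums over chains\<close>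

text \<open>The positions form \<open>y\<close> interleaved chains of step \<open>y\<close>, and the
  last \<open>y\<close> positions are their current ends. Appending \<open>Suc n\<close> extends
  only the chain that ends at \<open>Suc n - y\<close>; summing out the new state turns its
  potential into \<open>lam\<close> times the potential of the old end.\<close>

lemma chain_sum_step:
  fixes v :: "'a \<Rightarrow> real" and c :: "nat \<Rightarrow> 'a \<Rightarrow> real"
  assumes y: "1 \<le> y" "y \<le> n"
    and fin: "\<And>i. finite (St i)"
    and nonneg: "\<And>q. 0 \<le> v q" "\<And>i q. 0 \<le> c i q"
    and step: "\<And>p. p \<in> St (Suc n - y) \<Longrightarrow>
      (\<Sum>q\<in>{q \<in> St (Suc n). ok p q}. v q * c (Suc n) q) \<le> lam * c (Suc n - y) p"
  shows "(\<Sum>p\<in>{p \<in> PiE {1..Suc n} St. \<forall>i\<in>{y<..Suc n}. ok (p (i - y)) (p i)}.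
            (\<Prod>i\<in>{1..Suc n}. v (p i)) * (\<Prod>i\<in>{Suc n - y<..Suc n}. c i (p i)))
       \<le> lam * (\<Sum>p\<in>{p \<in> PiE {1..n} St. \<forall>i\<in>{y<..n}. ok (p (i - y)) (p i)}.
            (\<Prod>i\<in>{1..n}. v (p i)) * (\<Prod>i\<in>{n - y<..n}. c i (p i)))"
proof -
  define X where "X = (\<lambda>n. {p \<in> PiE {1..n} St. \<forall>i\<in>{y<..n}. ok (p (i - y)) (p i)})"
  define Y where "Y = (\<lambda>p. {q \<in> St (Suc n). ok (p (Suc n - y)) q})"
  define h where "h = (\<lambda>(p::nat \<Rightarrow> 'a, q). p(Suc n := q))"
  have finX: "finite (X k)" for k
    unfolding X_def by (rule finite_subset[OF _ finite_PiE[of "{1..k}" St]]) (auto simp: fin)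
  have finY: "finite (Y p)" for p
    unfolding Y_def using fin by simp
  have inj: "inj_on h (SIGMA p:X n. Y p)"
  proof (rule inj_onI, clarify)
    fix p q p' q'
    assume a: "p \<in> X n" "p' \<in> X n" and e: "h (p, q) = h (p', q')"
    have "p i = p' i" for i
    proof (cases "i = Suc n")
      case True
      then show ?thesis using a by (auto simp: X_def PiE_def extensional_def)
    next
      case False
      then show ?thesis using fun_cong[OF e, of i] by (auto simp: h_def)
    qed
    moreover have "q = q'" using fun_cong[OF e, of "Suc n"] by (auto simp: h_def)
    ultimately show "p = p' \<and> q = q'" by auto
  qed
  have im: "X (Suc n) = h ` (SIGMA p:X n. Y p)"
  proof (intro equalityI subsetI)
    fix p assume p: "p \<in> X (Suc n)"
    let ?p = "p(Suc n := undefined)"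
    have "?p \<in> X n" using p by (auto simp: X_def PiE_def extensional_def Pi_def)
    moreover have "p (Suc n) \<in> Y ?p" using p y by (auto simp: X_def Y_def PiE_def Pi_def)
    ultimately show "p \<in> h ` (SIGMA p:X n. Y p)"
      by (intro image_eqI[of _ _ "(?p, p (Suc n))"]) (auto simp: h_def)
  next
    fix p assume "p \<in> h ` (SIGMA p:X n. Y p)"
    then obtain p' q where p: "p = p'(Suc n := q)" "p' \<in> X n" "q \<in> Y p'"
      by (auto simp: h_def)
    have "p \<in> PiE {1..Suc n} St"
      using p by (auto simp: X_def Y_def PiE_def extensional_def Pi_def)
    moreover have "ok (p (i - y)) (p i)" if "i \<in> {y<..Suc n}" for i
      using p that y by (auto simp: X_def Y_def)
    ultimately show "p \<in> X (Suc n)" by (auto simp: X_def)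
  qed
  have ins: "{n - y<..n} = insert (Suc n - y) {Suc n - y<..n}" "Suc n - y \<notin> {Suc n - y<..n}"
    using y by auto
  have ins2: "{Suc n - y<..Suc n} = insert (Suc n) {Suc n - y<..n}"
    using y by auto
  have cong1: "(\<Prod>i\<in>{1..Suc n}. v (h (p, q) i)) * (\<Prod>i\<in>{Suc n - y<..Suc n}. c i (h (p, q) i))
     = ((\<Prod>i\<in>{1..n}. v (p i)) * (\<Prod>i\<in>{Suc n - y<..n}. c i (p i))) * (v q * c (Suc n) q)" for p q
  proof -
    have "(\<Prod>i\<in>{1..Suc n}. v (h (p, q) i)) = (\<Prod>i\<in>{1..n}. v (h (p, q) i)) * v q"
      by (simp add: h_def)
    moreover have "(\<Prod>i\<in>{1..n}. v (h (p, q) i)) = (\<Prod>i\<in>{1..n}. v (p i))"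
      by (intro prod.cong) (auto simp: h_def)
    moreover have "(\<Prod>i\<in>{Suc n - y<..Suc n}. c i (h (p, q) i))
        = c (Suc n) q * (\<Prod>i\<in>{Suc n - y<..n}. c i (h (p, q) i))"
      unfolding ins2 by (subst prod.insert) (auto simp: h_def)
    moreover have "(\<Prod>i\<in>{Suc n - y<..n}. c i (h (p, q) i)) = (\<Prod>i\<in>{Suc n - y<..n}. c i (p i))"
      by (intro prod.cong) (auto simp: h_def)
    ultimately show ?thesis by (simp only: mult_ac)
  qed
  have "(\<Sum>p\<in>X (Suc n). (\<Prod>i\<in>{1..Suc n}. v (p i)) * (\<Prod>i\<in>{Suc n - y<..Suc n}. c i (p i)))
     = (\<Sum>(p,q)\<in>(SIGMA p:X n. Y p).
          ((\<Prod>i\<in>{1..n}. v (p i)) * (\<Prod>i\<in>{Suc n - y<..n}. c i (p i))) * (v q * c (Suc n) q))"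
    unfolding im by (subst sum.reindex[OF inj], rule sum.cong) (auto simp only: o_def cong1)
  also have "\<dots> = (\<Sum>p\<in>X n. ((\<Prod>i\<in>{1..n}. v (p i)) * (\<Prod>i\<in>{Suc n - y<..n}. c i (p i)))
       * (\<Sum>q\<in>Y p. v q * c (Suc n) q))"
    using finX finY by (simp add: sum.Sigma[symmetric] sum_distrib_left)
  also have "\<dots> \<le> (\<Sum>p\<in>X n. ((\<Prod>i\<in>{1..n}. v (p i)) * (\<Prod>i\<in>{Suc n - y<..n}. c i (p i)))
       * (lam * c (Suc n - y) (p (Suc n - y))))"
  proof (intro sum_mono mult_left_mono)
    fix p assume p: "p \<in> X n"
    have "p (Suc n - y) \<in> St (Suc n - y)"
      using p y unfolding X_def by (intro PiE_mem[of p "{1..n}"]) auto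
    from step[OF this] show "(\<Sum>q\<in>Y p. v q * c (Suc n) q) \<le> lam * c (Suc n - y) (p (Suc n - y))"
      by (simp add: Y_def)
  qed (intro mult_nonneg_nonneg prod_nonneg nonneg ballI)
  also have "\<dots> = lam * (\<Sum>p\<in>X n. (\<Prod>i\<in>{1..n}. v (p i)) * (\<Prod>i\<in>{n - y<..n}. c i (p i)))"
    unfolding sum_distrib_left using ins
    by (intro sum.cong refl) (auto simp: prod.insert mult_ac)
  finally show ?thesis unfolding X_def .
qed

text \<open>Summing out positions from the last one backwards leaves a factor \<open>lam\<close> for
  each position that continues a chain and a free sum for each of the \<open>min y N\<close> chain
  starts. By \<open>last\<close> the potential is 1 on the final window, so none appears on the
  left.\<close>

lemma chain_sum_le:
  fixes v :: "'a \<Rightarrow> real" and c :: "nat \<Rightarrow> 'a \<Rightarrow> real"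
  assumes y: "1 \<le> y" and lam: "0 \<le> lam"
    and fin: "\<And>i. finite (St i)"
    and nonneg: "\<And>q. 0 \<le> v q" "\<And>i q. 0 \<le> c i q"
    and step: "\<And>n p. y < n \<Longrightarrow> n \<le> N \<Longrightarrow> p \<in> St (n - y) \<Longrightarrow>
      (\<Sum>q\<in>{q \<in> St n. ok p q}. v q * c n q) \<le> lam * c (n - y) p"
    and last: "\<And>i q. N < i + y \<Longrightarrow> c i q = 1"
  shows "(\<Sum>p\<in>{p \<in> PiE {1..N} St. \<forall>i\<in>{y<..N}. ok (p (i - y)) (p i)}. \<Prod>i\<in>{1..N}. v (p i))
       \<le> lam ^ (N - min y N) * (\<Prod>i\<in>{1..min y N}. \<Sum>q\<in>St i. v q * c i q)"
proof -
  define P where "P = (\<lambda>n. \<Sum>p\<in>{p \<in> PiE {1..n} St. \<forall>i\<in>{y<..n}. ok (p (i - y)) (p i)}.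
     (\<Prod>i\<in>{1..n}. v (p i)) * (\<Prod>i\<in>{n - y<..n}. c i (p i)))"
  have "P (min y N + j) \<le> lam ^ j * P (min y N)" if "min y N + j \<le> N" for j
    using that
  proof (induction j)
    case (Suc j)
    have yN: "min y N = y" and le: "Suc (y + j) \<le> N" using Suc.prems by auto
    have "P (min y N + Suc j) \<le> lam * P (min y N + j)"
      unfolding P_def add_Suc_right yN
    proof (rule chain_sum_step)
      fix p assume "p \<in> St (Suc (y + j) - y)"
      then show "(\<Sum>q\<in>{q \<in> St (Suc (y + j)). ok p q}. v q * c (Suc (y + j)) q)
          \<le> lam * c (Suc (y + j) - y) p"
        using le by (intro step) auto
    qed (use y fin nonneg in auto)
    also have "\<dots> \<le> lam * (lam ^ j * P (min y N))"
      by (intro mult_left_mono Suc.IH lam) (use Suc.prems in auto)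
    finally show ?case by simp
  qed simp
  from this[of "N - min y N"] have "P N \<le> lam ^ (N - min y N) * P (min y N)" by simp
  moreover have "P N = (\<Sum>p\<in>{p \<in> PiE {1..N} St. \<forall>i\<in>{y<..N}. ok (p (i - y)) (p i)}. \<Prod>i\<in>{1..N}. v (p i))"
    unfolding P_def by (intro sum.cong refl, subst prod.neutral[of "{N - y<..N}"]) (auto intro!: last)
  moreover have "P (min y N) = (\<Prod>i\<in>{1..min y N}. \<Sum>q\<in>St i. v q * c i q)"
  proof -
    let ?n = "min y N"
    have e: "{?n - y<..?n} = {1..?n}" by auto
    have "P ?n = (\<Sum>p\<in>PiE {1..?n} St. \<Prod>i\<in>{1..?n}. v (p i) * c i (p i))"
      unfolding P_def e prod.distrib by (intro sum.cong refl) auto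
    also have "\<dots> = (\<Prod>i\<in>{1..?n}. \<Sum>q\<in>St i. v q * c i q)"
      by (rule prod_sum_PiE[symmetric]) (auto simp: fin)
    finally show ?thesis .
  qed
  ultimately show ?thesis by simp
qed

section \<open>The transfer matrix of reflected pairs\<close>

definition tau :: real where
  "tau = (sqrt 5 - 1) / 2"

lemma tau_sq: "tau ^ 2 = 1 - tau"
  by (simp add: tau_def power2_eq_square field_simps)

lemma tau_bounds: "0.618033988 < tau" "tau < 0.618033989"
proof -
  have "2.236067977 < sqrt 5" by (rule real_less_rsqrt) (simp add: power2_eq_square)
  then show "0.618033988 < tau" by (simp add: tau_def)
  have "sqrt 5 < 2.236067978" by (rule real_less_lsqrt) (simp_all add: power2_eq_square)
  then show "tau < 0.618033989" by (simp add: tau_def)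
qed

lemma tau_pos: "0 < tau" and tau_less_1: "tau < 1"
  using tau_bounds by auto

text \<open>Every power becomes linear in \<open>tau\<close>, so the finite checks below are linear
  arithmetic. The coefficients are Fibonacci numbers up to 55, and nine decimals in
  \<open>tau_bounds\<close> keep the error far below the tolerance 0.000002.\<close>

lemma tau_powers:
  "tau ^ 3 = 2 * tau - 1" "tau ^ 4 = 2 - 3 * tau" "tau ^ 5 = 5 * tau - 3"
  "tau ^ 6 = 5 - 8 * tau" "tau ^ 7 = 13 * tau - 8" "tau ^ 8 = 13 - 21 * tau"
  "tau ^ 9 = 34 * tau - 21" "tau ^ 10 = 34 - 55 * tau" "tau * (tau * tau) = 2 * tau - 1"
proof -
  have s: "tau ^ Suc (Suc n) = tau ^ n - tau ^ Suc n" for n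
  proof -
    have "tau ^ Suc (Suc n) = tau ^ 2 * tau ^ n" by (simp add: power2_eq_square)
    also have "\<dots> = tau ^ n - tau ^ Suc n" unfolding tau_sq by (simp add: algebra_simps)
    finally show ?thesis .
  qed
  show "tau ^ 3 = 2 * tau - 1" "tau ^ 4 = 2 - 3 * tau" "tau ^ 5 = 5 * tau - 3"
    "tau ^ 6 = 5 - 8 * tau" "tau ^ 7 = 13 * tau - 8" "tau ^ 8 = 13 - 21 * tau"
    "tau ^ 9 = 34 * tau - 21" "tau ^ 10 = 34 - 55 * tau" "tau * (tau * tau) = 2 * tau - 1"
    using s[of 0] s[of 1] s[of 2] s[of 3] s[of 4] s[of 5] s[of 6] s[of 7] s[of 8]
    by (simp_all add: eval_nat_numeral)
qed

text \<open>
  A state is a pair of letters at reflected positions i and n + 1 - i of a word of length n. Along a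
  step from i to i + y the first letter moves forward and the second one backward, hence the
  asymmetric shape of the transition relation.
\<close>

definition pair_states :: "nat \<Rightarrow> (nat \<times> nat) set" where
  "pair_states s = {q \<in> {1..s} \<times> {1..s}. s \<le> fst q + snd q}"

definition pair_step :: "nat \<times> nat \<Rightarrow> nat \<times> nat \<Rightarrow> bool" where
  "pair_step p q \<longleftrightarrow> (fst p = 1 \<longrightarrow> fst q \<le> 2) \<and> (snd q = 1 \<longrightarrow> snd p \<le> 2)"

definition pair_weight :: "nat \<times> nat \<Rightarrow> real" where
  "pair_weight q = tau ^ (fst q + snd q)"

text \<open>The transfer matrix applied to the constant vector 1. Some of these row sums exceed 1
  for \<open>s\<close> equal to 3 or 4, so as numbers they do not show contraction; as a vector they
  replace the Perron eigenvector.\<close>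

definition succ_weight :: "nat \<Rightarrow> nat \<times> nat \<Rightarrow> real" where
  "succ_weight s p = (\<Sum>q\<in>{q \<in> pair_states s. pair_step p q}. pair_weight q)"

lemma finite_pair_states [simp]: "finite (pair_states s)"
  unfolding pair_states_def by simp

lemma pair_weight_nonneg [simp]: "0 \<le> pair_weight q"
  using tau_pos by (simp add: pair_weight_def)

lemma sum_pair_states:
  "(\<Sum>q\<in>{q \<in> pair_states s. P q}. f q) =
   (\<Sum>a\<in>{1..s}. \<Sum>b\<in>{1..s}. if s \<le> a + b \<and> P (a, b) then f (a, b) else (0::real))"
proof -
  have "{q \<in> pair_states s. P q} = {q \<in> {1..s} \<times> {1..s}. s \<le> fst q + snd q \<and> P q}"
    by (auto simp: pair_states_def)
  then show ?thesis
    by (simp add: sum.inter_filter sum.cartesian_product)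
      (auto intro!: sum.cong)
qed

lemma sum_all_pair_states:
  "(\<Sum>q\<in>pair_states s. f q) =
   (\<Sum>a\<in>{1..s}. \<Sum>b\<in>{1..s}. if s \<le> a + b then f (a, b) else (0::real))"
  using sum_pair_states[where P = "\<lambda>_. True" and f = f and s = s] by simp

lemma atLeastAtMost_3_4_5:
  "{Suc 0..3} = {1,2,3}" "{Suc 0..4} = {1,2,3,4}" "{Suc 0..5} = {1,2,3,4,5}"
  by auto

text \<open>Decimal upper bounds of the row sums of the transfer matrix, sharp up to 2 * 10^(-6).\<close>

definition succ_weight_approx :: "nat \<Rightarrow> bool \<Rightarrow> bool \<Rightarrow> real" where
  "succ_weight_approx s X Y = (if s = 3 then (if X then if Y then 0.618034 else 0.854102 else if Y then 0.763933 else 1.145899)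
     else if s = 4 then (if X then 0.527865 else if Y then 0.819661 else 1.055729)
     else (if X then 0.326238 else if Y then 0.729491 else 0.875389))"

text \<open>\<open>pair_step (a, b)\<close> depends only on whether \<open>a = 1\<close> and whether
  \<open>b > 2\<close>, so four values per \<open>s\<close> suffice. For \<open>s\<close> at least
  4, a successor with first letter at most 2 has second letter at least 2, so for
  \<open>a = 1\<close> the size of \<open>b\<close> has no influence.\<close>

lemma succ_weight_bounds:
  assumes "s \<in> {3, 4, 5}"
  shows "succ_weight s (a, b) \<le> succ_weight_approx s (a = 1) (b > 2)"
    and "succ_weight_approx s (a = 1) (b > 2) - 0.000002 \<le> succ_weight s (a, b)"
  using assms tau_bounds
  by (auto simp: succ_weight_def sum_pair_states atLeastAtMost_3_4_5 pair_step_def pair_weight_def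
     tau_powers tau_sq succ_weight_approx_def)

text \<open>A Collatz-Wielandt certificate: a positive vector that the matrix shrinks by 0.98 shows
  that the spectral radius is at most 0.98. The left side uses the upper decimals and the right side
  the lower ones.\<close>

lemma succ_weight_step:
  assumes "s \<in> {3, 4, 5}" "p \<in> pair_states s"
  shows "(\<Sum>q\<in>{q \<in> pair_states s. pair_step p q}. pair_weight q * succ_weight s q)
     \<le> 0.98 * succ_weight s p"
proof -
  obtain a b where p: "p = (a, b)" by force
  have "(\<Sum>q\<in>{q \<in> pair_states s. pair_step p q}. pair_weight q * succ_weight s q)
    \<le> (\<Sum>q\<in>{q \<in> pair_states s. pair_step p q}. pair_weight q * succ_weight_approx s (fst q = 1) (snd q > 2))"
    using succ_weight_bounds(1)[OF assms(1)] by (intro sum_mono mult_left_mono) auto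
  moreover have "1 \<le> a" "a \<le> s" "1 \<le> b" "b \<le> s" "s \<le> a + b"
    using assms(2) p by (auto simp: pair_states_def)
  then have "(\<Sum>q\<in>{q \<in> pair_states s. pair_step p q}. pair_weight q * succ_weight_approx s (fst q = 1) (snd q > 2))
    \<le> 0.98 * (succ_weight_approx s (a = 1) (b > 2) - 0.000002)"
    using assms(1) tau_bounds
    by (auto simp: p sum_pair_states atLeastAtMost_3_4_5 pair_step_def pair_weight_def
       tau_powers tau_sq succ_weight_approx_def field_simps)
  ultimately have "(\<Sum>q\<in>{q \<in> pair_states s. pair_step p q}. pair_weight q * succ_weight s q)
    \<le> 0.98 * (succ_weight_approx s (a = 1) (b > 2) - 0.000002)"
    by linarith
  also have "\<dots> \<le> 0.98 * succ_weight s p"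
    using succ_weight_bounds(2)[OF assms(1), of a b] p by simp
  finally show ?thesis .
qed

text \<open>The contribution of the first state of a chain, once for chains of a single state
  (potential 1) and once for longer ones. An unrestricted start may exceed 1; forcing one letter to
  be at least 2 brings it below 0.86, and forcing both brings it below 0.7396 = 0.86^2, so each
  forced letter counts as one factor 0.86.\<close>

lemma start_bounds:
  assumes "s \<in> {3, 4, 5}"
  shows "(\<Sum>q\<in>pair_states s. pair_weight q) \<le> 1.15"
    and "(\<Sum>q\<in>{q \<in> pair_states s. 2 \<le> fst q}. pair_weight q) \<le> 0.86"
    and "(\<Sum>q\<in>{q \<in> pair_states s. 2 \<le> fst q \<and> 2 \<le> snd q}. pair_weight q) \<le> 0.7396"
    and "(\<Sum>q\<in>pair_states s. pair_weight q * (succ_weight s q / 0.98)) \<le> 1.15"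
    and "(\<Sum>q\<in>{q \<in> pair_states s. 2 \<le> fst q}. pair_weight q * (succ_weight s q / 0.98)) \<le> 0.86"
    and "(\<Sum>q\<in>{q \<in> pair_states s. 2 \<le> fst q \<and> 2 \<le> snd q}. pair_weight q * (succ_weight s q / 0.98)) \<le> 0.7396"
proof -
  have le: "(\<Sum>q\<in>{q \<in> pair_states s. P q}. pair_weight q * (succ_weight s q / 0.98))
     \<le> (\<Sum>q\<in>{q \<in> pair_states s. P q}. pair_weight q * (succ_weight_approx s (fst q = 1) (snd q > 2) / 0.98))" for P
    using succ_weight_bounds(1)[OF assms(1)] by (intro sum_mono mult_left_mono divide_right_mono) auto
  have le0: "(\<Sum>q\<in>pair_states s. pair_weight q * (succ_weight s q / 0.98))
     \<le> (\<Sum>q\<in>pair_states s. pair_weight q * (succ_weight_approx s (fst q = 1) (snd q > 2) / 0.98))"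
    using succ_weight_bounds(1)[OF assms(1)] by (intro sum_mono mult_left_mono divide_right_mono) auto
  note d = sum_pair_states atLeastAtMost_3_4_5 pair_step_def pair_weight_def
       tau_powers tau_sq succ_weight_approx_def
  show "(\<Sum>q\<in>pair_states s. pair_weight q) \<le> 1.15"
    using assms tau_bounds by (auto simp: sum_all_pair_states d)
  show "(\<Sum>q\<in>{q \<in> pair_states s. 2 \<le> fst q}. pair_weight q) \<le> 0.86"
    using assms tau_bounds by (auto simp: d)
  show "(\<Sum>q\<in>{q \<in> pair_states s. 2 \<le> fst q \<and> 2 \<le> snd q}. pair_weight q) \<le> 0.7396"
    using assms tau_bounds by (auto simp: d)
  show "(\<Sum>q\<in>pair_states s. pair_weight q * (succ_weight s q / 0.98)) \<le> 1.15"
    by (rule order.trans[OF le0]) (use assms tau_bounds in \<open>auto simp: sum_all_pair_states d field_simps\<close>)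
  show "(\<Sum>q\<in>{q \<in> pair_states s. 2 \<le> fst q}. pair_weight q * (succ_weight s q / 0.98)) \<le> 0.86"
    by (rule order.trans[OF le]) (use assms tau_bounds in \<open>auto simp: d field_simps\<close>)
  show "(\<Sum>q\<in>{q \<in> pair_states s. 2 \<le> fst q \<and> 2 \<le> snd q}. pair_weight q * (succ_weight s q / 0.98)) \<le> 0.7396"
    by (rule order.trans[OF le]) (use assms tau_bounds in \<open>auto simp: d field_simps\<close>)
qed

section \<open>Weighted counts of words\<close>

text \<open>
  The Kunz word splits at r into two such segments. In each of them s is both the largest letter and
  the lower bound for the sum of two reflected letters, y is the shift and the first e positions are
  those before the first letter 1.
\<close>

definition segment_words :: "nat \<Rightarrow> nat \<Rightarrow> nat \<Rightarrow> nat \<Rightarrow> (nat \<Rightarrow> nat) set" where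
  "segment_words n s y e = {w \<in> PiE {1..n} (\<lambda>_. {1..s}).
     (\<forall>i\<in>{1..n}. s \<le> w i + w (n + 1 - i)) \<and>
     (\<forall>i. 1 \<le> i \<and> i + y \<le> n \<and> w i = 1 \<longrightarrow> w (i + y) \<le> 2) \<and>
     (\<forall>i\<in>{1..n}. i \<le> e \<longrightarrow> 2 \<le> w i)}"

definition segment_sum :: "nat \<Rightarrow> nat \<Rightarrow> nat \<Rightarrow> nat \<Rightarrow> real" where
  "segment_sum n s y e = (\<Sum>w\<in>segment_words n s y e. \<Prod>i\<in>{1..n}. tau ^ w i)"

lemma finite_segment_words [simp]: "finite (segment_words n s y e)"
  by (rule finite_subset[of _ "PiE {1..n} (\<lambda>_. {1..s})"])
     (auto simp: segment_words_def intro!: finite_PiE)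

lemma segment_sum_nonneg: "0 \<le> segment_sum n s y e"
  unfolding segment_sum_def using tau_pos by (intro sum_nonneg prod_nonneg) auto

lemma sum_le_sum_inj_on:
  fixes f :: "'a \<Rightarrow> real"
  assumes "inj_on h A" "h ` A \<subseteq> B" "finite B" "\<And>b. b \<in> B \<Longrightarrow> 0 \<le> g b" "\<And>a. a \<in> A \<Longrightarrow> f a \<le> g (h a)"
  shows "sum f A \<le> sum g B"
proof -
  have "sum f A \<le> (\<Sum>a\<in>A. g (h a))" by (intro sum_mono assms)
  also have "\<dots> = sum g (h ` A)" using assms(1) by (simp add: sum.reindex)
  also have "\<dots> \<le> sum g B" by (rule sum_mono2) (use assms in auto)
  finally show ?thesis .
qed

lemma prod_reflect_pairs:
  fixes f :: "nat \<Rightarrow> real"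
  shows "(\<Prod>i\<in>{1..n}. f i) = (\<Prod>i\<in>{1..n div 2}. f i * f (n + 1 - i)) * (if odd n then f (n div 2 + 1) else 1)"
proof -
  let ?N = "n div 2"
  have r: "(\<Prod>i\<in>{n - ?N + 1..n}. f i) = (\<Prod>i\<in>{1..?N}. f (n + 1 - i))"
    by (rule prod.reindex_bij_witness[of _ "\<lambda>i. n + 1 - i" "\<lambda>i. n + 1 - i"]) auto
  have "{1..n} = {1..?N} \<union> {?N + 1..n}" by auto
  then have "(\<Prod>i\<in>{1..n}. f i) = (\<Prod>i\<in>{1..?N}. f i) * (\<Prod>i\<in>{?N + 1..n}. f i)"
    by (simp add: prod.union_disjoint)
  also have "(\<Prod>i\<in>{?N + 1..n}. f i) = (\<Prod>i\<in>{n - ?N + 1..n}. f i) * (if odd n then f (?N + 1) else 1)"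
  proof (cases "odd n")
    case True
    then have "{?N + 1..n} = insert (?N + 1) {n - ?N + 1..n}" "?N + 1 \<notin> {n - ?N + 1..n}"
      by (auto elim!: oddE)
    then show ?thesis using True by (simp add: mult.commute)
  next
    case False
    then show ?thesis by (auto elim!: evenE)
  qed
  finally show ?thesis unfolding r by (simp add: prod.distrib mult_ac)
qed

text \<open>Fold the word in the middle. If position \<open>i\<close> carries the pair of
  \<open>i\<close> and \<open>n + 1 - i\<close>, the shift from \<open>n + 1 - i\<close> leads to
  \<open>n + 1 - (i - y)\<close>, the second letter of the pair at \<open>i - y\<close>. Shift
  conditions that cross the middle are given up, which only enlarges the sum. The middle letter of
  an odd word is its own reflection, hence \<open>s \<le> 2 * k\<close>.\<close>

lemma segment_sum_le_pairs:
  fixes n s y e :: nat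
  assumes y: "1 \<le> y"
  defines "N \<equiv> n div 2"
  defines "St \<equiv> (\<lambda>i. {q \<in> pair_states s. (i \<le> e \<longrightarrow> 2 \<le> fst q) \<and> (n + 1 - i \<le> e \<longrightarrow> 2 \<le> snd q)})"
  shows "segment_sum n s y e \<le>
     (\<Sum>p\<in>{p \<in> PiE {1..N} St. \<forall>i\<in>{y<..N}. pair_step (p (i - y)) (p i)}. \<Prod>i\<in>{1..N}. pair_weight (p i))
     * (if odd n then \<Sum>k\<in>{k \<in> {1..s}. s \<le> 2 * k}. tau ^ k else 1)"
proof -
  define X where "X = {p \<in> PiE {1..N} St. \<forall>i\<in>{y<..N}. pair_step (p (i - y)) (p i)}"
  \<comment> \<open>For even \<open>n\<close> the dummy letter 0 has weight
    \<open>tau ^ 0 = 1\<close>, so both parities fit one product.\<close>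
  define Mid where "Mid = (if odd n then {k \<in> {1..s}. s \<le> 2 * k} else {0})"
  define h where "h = (\<lambda>w::nat \<Rightarrow> nat. (\<lambda>i\<in>{1..N}. (w i, w (n + 1 - i)), if odd n then w (N + 1) else 0))"
  have "finite (PiE {1..N} St)" by (intro finite_PiE) (auto simp: St_def)
  then have finX: "finite X" unfolding X_def by simp
  have finMid: "finite Mid" by (simp add: Mid_def)
  have "segment_sum n s y e \<le> (\<Sum>(p, k)\<in>X \<times> Mid. (\<Prod>i\<in>{1..N}. pair_weight (p i)) * tau ^ k)"
    unfolding segment_sum_def
  proof (rule sum_le_sum_inj_on[of h])
    show "inj_on h (segment_words n s y e)"
    proof (rule inj_onI)
      fix w w' assume w: "w \<in> segment_words n s y e" "w' \<in> segment_words n s y e" and e: "h w = h w'"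
      have E: "w i = w' i \<and> w (n + 1 - i) = w' (n + 1 - i)" if "i \<in> {1..N}" for i
        using fun_cong[OF arg_cong[OF e, of fst], of i] that by (auto simp: h_def)
      have "w i = w' i" if i: "i \<in> {1..n}" for i
      proof -
        consider "i \<in> {1..N}" | "n + 1 - i \<in> {1..N}" | "odd n" "i = N + 1"
        proof -
          have "i \<le> n div 2 \<or> n + 1 - i \<le> n div 2 \<or> (odd n \<and> i = n div 2 + 1)" by presburger
          then show ?thesis using that i by (auto simp: N_def)
        qed
        then show ?thesis
        proof cases
          case 2
          then show ?thesis using E[of "n + 1 - i"] i by auto
        qed (use E e in \<open>auto simp: h_def\<close>)
      qed
      then show "w = w'" using w unfolding segment_words_def
        by (intro PiE_ext[of w "{1..n}" _ w']) auto
    qed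
    show "h ` segment_words n s y e \<subseteq> X \<times> Mid"
    proof (rule image_subsetI)
      fix w assume w: "w \<in> segment_words n s y e"
      then have r: "w i \<in> {1..s}" if "i \<in> {1..n}" for i using that by (auto simp: segment_words_def PiE_def Pi_def)
      have p: "s \<le> w i + w (n + 1 - i)" if "i \<in> {1..n}" for i using w that by (auto simp: segment_words_def)
      have sh: "w (i + y) \<le> 2" if "1 \<le> i" "i + y \<le> n" "w i = 1" for i using w that by (auto simp: segment_words_def)
      have re: "2 \<le> w i" if "i \<in> {1..n}" "i \<le> e" for i using w that by (auto simp: segment_words_def)
      have "fst (h w) i \<in> St i" if i: "i \<in> {1..N}" for i
      proof -
        have "i \<in> {1..n}" "n + 1 - i \<in> {1..n}" using i by (auto simp: N_def)
        then show ?thesis using r p re i unfolding h_def St_def pair_states_def by auto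
      qed
      moreover have "pair_step (fst (h w) (i - y)) (fst (h w) i)" if i: "i \<in> {y<..N}" for i
      proof -
        have e: "n + 1 - i + y = n + 1 - (i - y)" using i by (auto simp: N_def)
        show ?thesis using i y sh[of "i - y"] sh[of "n + 1 - i"] unfolding e
          by (auto simp: h_def pair_step_def N_def)
      qed
      ultimately have "fst (h w) \<in> X" unfolding X_def by (auto simp: h_def)
      moreover have "snd (h w) \<in> Mid"
      proof (cases "odd n")
        case True
        then have "N + 1 \<in> {1..n}" "n + 1 - (N + 1) = N + 1" unfolding N_def by (auto elim!: oddE)
        then show ?thesis using r[of "N + 1"] p[of "N + 1"] True by (auto simp: h_def Mid_def)
      qed (auto simp: h_def Mid_def)
      ultimately show "h w \<in> X \<times> Mid" by (simp add: mem_Times_iff)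
    qed
    show "finite (X \<times> Mid)" using finX finMid by simp
    show "(\<Prod>i\<in>{1..n}. tau ^ w i) \<le> (case h w of (p, k) \<Rightarrow> (\<Prod>i\<in>{1..N}. pair_weight (p i)) * tau ^ k)" for w
    proof -
      have "(\<Prod>i\<in>{1..n}. tau ^ w i) =
        (\<Prod>i\<in>{1..N}. tau ^ w i * tau ^ w (n + 1 - i)) * (if odd n then tau ^ w (N + 1) else 1)"
        unfolding N_def by (rule prod_reflect_pairs)
      also have "(\<Prod>i\<in>{1..N}. tau ^ w i * tau ^ w (n + 1 - i)) = (\<Prod>i\<in>{1..N}. pair_weight (fst (h w) i))"
        by (intro prod.cong) (auto simp: h_def pair_weight_def power_add)
      finally show ?thesis by (auto simp: case_prod_unfold h_def)
    qed
    show "0 \<le> (case b of (p, k) \<Rightarrow> (\<Prod>i\<in>{1..N}. pair_weight (p i)) * tau ^ k)" for b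
      using tau_pos by (auto simp: case_prod_unfold intro!: mult_nonneg_nonneg prod_nonneg)
  qed
  also have "\<dots> = (\<Sum>p\<in>X. \<Prod>i\<in>{1..N}. pair_weight (p i)) * (\<Sum>k\<in>Mid. tau ^ k)"
    by (simp add: sum.cartesian_product[symmetric] sum_product)
  also have "(\<Sum>k\<in>Mid. tau ^ k) = (if odd n then \<Sum>k\<in>{k \<in> {1..s}. s \<le> 2 * k}. tau ^ k else 1)"
    by (simp add: Mid_def)
  finally show ?thesis unfolding X_def .
qed

lemma sum_middle_le_1:
  assumes "s \<in> {3, 4, 5}"
  shows "(\<Sum>k\<in>{k \<in> {1..s}. s \<le> 2 * k}. tau ^ k) \<le> 1"
proof -
  have "{k \<in> {1..3::nat}. 3 \<le> 2 * k} = {2, 3}" "{k \<in> {1..4::nat}. 4 \<le> 2 * k} = {2, 3, 4}"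
    "{k \<in> {1..5::nat}. 5 \<le> 2 * k} = {3, 4, 5}" by auto
  then show ?thesis using assms tau_bounds
    by (auto simp: tau_powers tau_sq simp del: atLeastAtMost_iff mem_Collect_eq)
qed

text \<open>The potential of a state is 1 at the end of a chain and the normalised row sum elsewhere.\<close>

lemma segment_sum_chain:
  assumes y: "1 \<le> y" and s: "s \<in> {3, 4, 5}"
  shows "segment_sum n s y e \<le> 0.98 ^ (n div 2 - min y (n div 2)) *
     (\<Prod>i\<in>{1..min y (n div 2)}. if i \<le> e then if n + 1 - i \<le> e then 0.7396 else 0.86 else 1.15)"
proof -
  define N where "N = n div 2"
  define St where "St = (\<lambda>i. {q \<in> pair_states s. (i \<le> e \<longrightarrow> 2 \<le> fst q) \<and> (n + 1 - i \<le> e \<longrightarrow> 2 \<le> snd q)})"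
  define c where "c = (\<lambda>i q. if N < i + y then 1 else succ_weight s q / 0.98)"
  have succ_weight_nonneg: "0 \<le> succ_weight s q" for q
    unfolding succ_weight_def by (intro sum_nonneg) simp
  have c_nonneg: "0 \<le> c i q" for i q
    using succ_weight_nonneg by (simp add: c_def)
  let ?A = "\<Sum>p\<in>{p \<in> PiE {1..N} St. \<forall>i\<in>{y<..N}. pair_step (p (i - y)) (p i)}. \<Prod>i\<in>{1..N}. pair_weight (p i)"
  have "segment_sum n s y e \<le> ?A * (if odd n then \<Sum>k\<in>{k \<in> {1..s}. s \<le> 2 * k}. tau ^ k else 1)"
    unfolding N_def St_def by (rule segment_sum_le_pairs[OF y])
  also have "\<dots> \<le> ?A * 1"
    using sum_middle_le_1[OF s] by (intro mult_left_mono sum_nonneg prod_nonneg) auto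
  also have "?A \<le> 0.98 ^ (N - min y N) * (\<Prod>i\<in>{1..min y N}. \<Sum>q\<in>St i. pair_weight q * c i q)"
  proof (rule chain_sum_le[OF y])
    show "finite (St i)" for i by (simp add: St_def)
    show "c i q = 1" if "N < i + y" for i q using that by (simp add: c_def)
    show "(\<Sum>q\<in>{q \<in> St k. pair_step p q}. pair_weight q * c k q) \<le> 0.98 * c (k - y) p"
      if k: "y < k" "k \<le> N" and p: "p \<in> St (k - y)" for k p
    proof -
      have ck: "c (k - y) p = succ_weight s p / 0.98" using k by (simp add: c_def)
      have "(\<Sum>q\<in>{q \<in> St k. pair_step p q}. pair_weight q * c k q)
        \<le> (\<Sum>q\<in>{q \<in> pair_states s. pair_step p q}. pair_weight q * c k q)"
        by (intro sum_mono2) (auto simp: St_def c_nonneg)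
      also have "\<dots> \<le> succ_weight s p"
      proof (cases "N < k + y")
        case True
        then show ?thesis by (simp add: c_def succ_weight_def)
      next
        case False
        have "p \<in> pair_states s" using p by (simp add: St_def)
        have "(\<Sum>q\<in>{q \<in> pair_states s. pair_step p q}. pair_weight q * c k q)
          = (\<Sum>q\<in>{q \<in> pair_states s. pair_step p q}. pair_weight q * succ_weight s q) / 0.98"
          using False by (simp only: c_def if_False times_divide_eq_right sum_divide_distrib)
        also have "\<dots> \<le> succ_weight s p"
          using succ_weight_step[OF s \<open>p \<in> pair_states s\<close>] by simp
        finally show ?thesis .
      qed
      finally show ?thesis by (simp add: ck)
    qed
  qed (auto simp: c_nonneg)
  also have "\<dots> \<le> 0.98 ^ (N - min y N) *
     (\<Prod>i\<in>{1..min y N}. if i \<le> e then if n + 1 - i \<le> e then 0.7396 else 0.86 else 1.15)"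
  proof (intro mult_left_mono prod_mono conjI)
    fix i assume i: "i \<in> {1..min y N}"
    show "0 \<le> (\<Sum>q\<in>St i. pair_weight q * c i q)"
      by (intro sum_nonneg mult_nonneg_nonneg c_nonneg) auto
    \<comment> \<open>In the first half a restricted second letter entails a restricted first one,
      so three cases remain.\<close>
    have "i \<le> n + 1 - i" using i by (auto simp: N_def)
    then consider "\<not> i \<le> e" "St i = pair_states s"
      | "i \<le> e" "\<not> n + 1 - i \<le> e" "St i = {q \<in> pair_states s. 2 \<le> fst q}"
      | "i \<le> e" "n + 1 - i \<le> e" "St i = {q \<in> pair_states s. 2 \<le> fst q \<and> 2 \<le> snd q}"
      by (auto simp: St_def)
    moreover have "c i = (\<lambda>_. 1) \<or> c i = (\<lambda>q. succ_weight s q / 0.98)"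
      by (cases "N < i + y") (simp_all add: c_def)
    ultimately show "(\<Sum>q\<in>St i. pair_weight q * c i q)
       \<le> (if i \<le> e then if n + 1 - i \<le> e then 0.7396 else 0.86 else 1.15)"
      using start_bounds[OF s] by cases (elim disjE; simp)+
  qed simp
  finally show ?thesis by (simp add: N_def)
qed

section \<open>Large alphabets, and the critical alphabet {1, 2}\<close>

lemma sum_tau_powers_le: "(\<Sum>b\<in>{l..u}. tau ^ b) \<le> tau ^ l / tau ^ 2"
proof (cases "l \<le> u")
  case True
  then have "(1 - tau) * (\<Sum>b\<in>{l..u}. tau ^ b) = tau ^ l - tau ^ Suc u"
    by (rule sum_gp_multiplied)
  also have "\<dots> \<le> tau ^ l" using tau_pos by simp
  finally show ?thesis unfolding tau_sq using tau_less_1 by (simp add: field_simps)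
qed (use tau_pos in auto)

text \<open>For each \<open>a\<close>, the geometric series over \<open>b\<close> from
  \<open>s - a\<close> on is at most tau^(s-a-2), since 1 - tau = tau^2. This yields s tau^(s-2),
  which exceeds 1 at \<open>s = 5\<close>, so that case is computed exactly. From 6 on the growth
  ratio \<open>tau * (k + 1) / k\<close> stays below 0.996.\<close>

lemma sum_pair_weight_le:
  assumes "5 \<le> s"
  shows "(\<Sum>q\<in>pair_states s. pair_weight q) \<le> 0.996 ^ s"
proof (cases "s = 5")
  case True
  then show ?thesis using tau_bounds
    by (auto simp: sum_all_pair_states atLeastAtMost_3_4_5 pair_weight_def tau_powers tau_sq power_divide)
next
  case False
  have "(\<Sum>q\<in>pair_states s. pair_weight q) =
      (\<Sum>a\<in>{1..s}. \<Sum>b\<in>{1..s}. if s \<le> a + b then tau ^ (a + b) else 0)"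
    unfolding sum_all_pair_states pair_weight_def fst_conv snd_conv ..
  also have "\<dots> \<le> (\<Sum>a\<in>{1..s}. tau ^ s / tau ^ 2)"
  proof (rule sum_mono)
    fix a assume a: "a \<in> {1..s}"
    have "(\<Sum>b\<in>{1..s}. if s \<le> a + b then tau ^ (a + b) else 0)
       = (\<Sum>b\<in>{b \<in> {1..s}. s \<le> a + b}. tau ^ (a + b))"
      by (rule sum.inter_filter[symmetric]) simp
    also have "\<dots> \<le> (\<Sum>b\<in>{s - a..s}. tau ^ (a + b))"
      by (rule sum_mono2) (use tau_pos in auto)
    also have "\<dots> = tau ^ a * (\<Sum>b\<in>{s - a..s}. tau ^ b)"
      by (simp add: power_add sum_distrib_left)
    also have "\<dots> \<le> tau ^ a * (tau ^ (s - a) / tau ^ 2)"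
      by (intro mult_left_mono sum_tau_powers_le) (use tau_pos in auto)
    also have "\<dots> = tau ^ s / tau ^ 2"
      using a by (simp flip: power_add)
    finally show "(\<Sum>b\<in>{1..s}. if s \<le> a + b then tau ^ (a + b) else 0) \<le> tau ^ s / tau ^ 2" .
  qed
  also have "\<dots> = real s * tau ^ s / tau ^ 2" by simp
  also have "real s * tau ^ s / tau ^ 2 \<le> 0.996 ^ s"
  proof -
    have "6 \<le> s" using assms False by simp
    then show ?thesis
    proof (induction s rule: dec_induct)
      case base
      show ?case using tau_bounds by (simp add: tau_powers tau_sq field_simps)
    next
      case (step k)
      have "real (Suc k) * tau \<le> 0.996 * real k"
      proof -
        have "real (Suc k) * tau \<le> real (Suc k) * 0.62"
          using tau_bounds by (intro mult_left_mono) auto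
        also have "\<dots> \<le> 0.996 * real k" using step.hyps by simp
        finally show ?thesis .
      qed
      then have "real (Suc k) * tau * (tau ^ k / tau ^ 2) \<le> 0.996 * real k * (tau ^ k / tau ^ 2)"
        using tau_pos by (intro mult_right_mono) auto
      also have "\<dots> \<le> 0.996 * 0.996 ^ k" using step.IH by simp
      finally show ?case by (simp add: mult_ac)
    qed
  qed
  finally show ?thesis .
qed

text \<open>The middle letter is half a pair, so its rate is the square root of the one for pairs:
  0.996 is below 0.998^2.\<close>

lemma sum_middle_le:
  assumes "5 \<le> s"
  shows "(\<Sum>k\<in>{k \<in> {1..s}. s \<le> 2 * k}. tau ^ k) \<le> 0.998 ^ s"
proof -
  define j where "j = (s + 1) div 2"
  have j: "3 \<le> j" "s \<le> 2 * j" using assms by (auto simp: j_def)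
  have "(\<Sum>k\<in>{k \<in> {1..s}. s \<le> 2 * k}. tau ^ k) \<le> (\<Sum>k\<in>{j..s}. tau ^ k)"
    by (rule sum_mono2) (use tau_pos in \<open>auto simp: j_def\<close>)
  also have "\<dots> \<le> tau ^ j / tau ^ 2" by (rule sum_tau_powers_le)
  also have "\<dots> \<le> 0.996 ^ j"
    using j(1)
  proof (induction j rule: dec_induct)
    case base
    show ?case using tau_bounds by (simp add: tau_powers tau_sq field_simps)
  next
    case (step k)
    have "tau * (tau ^ k / tau ^ 2) \<le> 0.996 * 0.996 ^ k"
      using step.IH tau_bounds by (intro mult_mono) auto
    then show ?case by simp
  qed
  also have "\<dots> \<le> (0.998 ^ 2) ^ j" by (rule power_mono) (simp_all add: power2_eq_square)
  also have "\<dots> = 0.998 ^ (2 * j)" by (rule power_mult[symmetric])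
  also have "\<dots> \<le> 0.998 ^ s" using j(2) by (intro power_decreasing) auto
  finally show ?thesis .
qed

text \<open>The exponent is \<open>s * n\<close> rather than \<open>n\<close> because F may be large
  while m stays small; the decay then has to come from the size of the letters.\<close>

lemma segment_sum_large_letters:
  assumes "1 \<le> y" "5 \<le> s"
  shows "segment_sum n s y e \<le> 0.998 ^ (s * n)"
proof -
  define N where "N = n div 2"
  define St where "St = (\<lambda>i. {q \<in> pair_states s. (i \<le> e \<longrightarrow> 2 \<le> fst q) \<and> (n + 1 - i \<le> e \<longrightarrow> 2 \<le> snd q)})"
  let ?M = "if odd n then \<Sum>k\<in>{k \<in> {1..s}. s \<le> 2 * k}. tau ^ k else 1"
  have M0: "0 \<le> ?M" using tau_pos by (auto intro!: sum_nonneg)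
  have "segment_sum n s y e \<le> (\<Sum>p\<in>{p \<in> PiE {1..N} St. \<forall>i\<in>{y<..N}. pair_step (p (i - y)) (p i)}. \<Prod>i\<in>{1..N}. pair_weight (p i)) * ?M"
    unfolding N_def St_def by (rule segment_sum_le_pairs[OF assms(1)])
  also have "\<dots> \<le> (\<Sum>p\<in>PiE {1..N} (\<lambda>_. pair_states s). \<Prod>i\<in>{1..N}. pair_weight (p i)) * ?M"
    by (intro mult_right_mono M0 sum_mono2 finite_PiE prod_nonneg) (auto simp: St_def PiE_def Pi_def)
  also have "\<dots> = (\<Sum>q\<in>pair_states s. pair_weight q) ^ N * ?M"
    by (subst prod_sum_PiE[symmetric]) auto
  also have "\<dots> \<le> (0.998 ^ (2 * s)) ^ N * (0.998 ^ s) ^ (if odd n then 1 else 0)"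
  proof (intro mult_mono power_mono M0)
    have "(\<Sum>q\<in>pair_states s. pair_weight q) \<le> 0.996 ^ s" by (rule sum_pair_weight_le[OF assms(2)])
    also have "\<dots> \<le> (0.998 ^ 2) ^ s" by (rule power_mono) (simp_all add: power2_eq_square)
    also have "\<dots> = 0.998 ^ (2 * s)" by (rule power_mult[symmetric])
    finally show "(\<Sum>q\<in>pair_states s. pair_weight q) \<le> 0.998 ^ (2 * s)" .
    show "?M \<le> (0.998 ^ s) ^ (if odd n then 1 else 0)"
      using sum_middle_le[OF assms(2)] by auto
  qed (auto intro!: sum_nonneg)
  also have "\<dots> = 0.998 ^ (2 * s * N + s * (if odd n then 1 else 0))"
    unfolding power_mult[symmetric] power_add[symmetric] ..
  also have "2 * s * N + s * (if odd n then 1 else 0) = s * n"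
    unfolding N_def by (auto elim!: oddE evenE)
  finally show ?thesis .
qed

text \<open>Each letter contributes at most tau + tau^2 = 1. This is the segment beyond r for K =
  3.\<close>

lemma segment_sum_two_letters:
  "segment_sum n 2 y e \<le> 1"
proof -
  have "segment_sum n 2 y e \<le> (\<Sum>w\<in>PiE {1..n} (\<lambda>_. {1..2}). \<Prod>i\<in>{1..n}. tau ^ w i)"
    unfolding segment_sum_def using tau_pos
    by (intro sum_mono2 finite_PiE prod_nonneg) (auto simp: segment_words_def)
  also have "\<dots> = (\<Prod>i\<in>{1..n}. \<Sum>k\<in>{1..2}. tau ^ k)"
    by (rule prod_sum_PiE[symmetric]) auto
  also have "(\<Sum>k\<in>{1..2}. tau ^ k) = 1"
  proof -
    have "{1..2::nat} = {1, 2}" by auto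
    then show ?thesis using tau_sq by simp
  qed
  finally show ?thesis by simp
qed

section \<open>Small alphabets\<close>

text \<open>Count the restricted letters among the starts, with one factor 0.86 for each:
  \<open>min e M\<close> are first letters, and \<open>M - (n - e)\<close> are second
  letters.\<close>

lemma prod_start_factors:
  assumes "M \<le> n div 2"
  shows "(\<Prod>i\<in>{1..M}. if i \<le> e then if n + 1 - i \<le> e then 0.7396 else 0.86 else (1.15::real))
    = 1.15 ^ (M - e) * 0.86 ^ (min e M + (M - (n - e)))"
  using assms
proof (induction M)
  case (Suc M)
  have IH: "(\<Prod>i\<in>{1..M}. if i \<le> e then if n + 1 - i \<le> e then 0.7396 else 0.86 else (1.15::real))
    = 1.15 ^ (M - e) * 0.86 ^ (min e M + (M - (n - e)))"
    using Suc by simp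
  consider "e < Suc M" "M - (n - e) = 0" "Suc M - (n - e) = 0" "Suc M - e = Suc (M - e)" "min e (Suc M) = min e M"
    | "Suc M \<le> e" "n - M \<le> e" "Suc M - (n - e) = Suc (M - (n - e))"
    | "Suc M \<le> e" "\<not> n - M \<le> e" "Suc M - (n - e) = M - (n - e)"
    using Suc.prems by force
  then show ?case
    unfolding prod.cl_ivl_Suc using IH by cases (simp_all add: power_add power2_eq_square)
qed simp

lemma segment_sum_le:
  assumes "1 \<le> y" "s \<in> {3, 4, 5}" "M = min y (n div 2)"
  shows "segment_sum n s y e \<le> 0.98 ^ (n div 2 - M) * (1.15 ^ (M - e) * 0.86 ^ (min e M + (M - (n - e))))"
  using segment_sum_chain[OF assms(1,2), of n e] prod_start_factors[of M n e] assms(3) by simp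

lemma power_nat_diff_le:
  fixes x :: real
  assumes "0 < x" "x \<le> 1"
  shows "x ^ (a - c) \<le> x ^ a / x ^ c"
proof -
  have "x ^ (a - c) * x ^ c \<le> x ^ a"
    unfolding power_add[symmetric] using assms by (intro power_decreasing) auto
  then show ?thesis using assms by (simp add: field_simps)
qed

text \<open>With \<open>e = y - 1\<close> the only start without restriction can be
  \<open>i = y\<close>, so 1.15 occurs at most once. The number of restricted letters is at least
  \<open>min y r - 2\<close>; the two missing factors and the 1.15 are covered by 1.15 / 0.86^2 <
  2.\<close>

lemma long_segment_le:
  assumes "1 \<le> y" "s \<in> {3, 4, 5}" "1 \<le> r"
  shows "segment_sum (r - 1) s y (y - 1)
    \<le> 2 * (0.98 ^ ((r - 1) div 2 - min y ((r - 1) div 2)) * 0.86 ^ min y r)"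
proof -
  define N where "N = (r - 1) div 2"
    have "segment_sum (r - 1) s y (y - 1)
    \<le> 0.98 ^ (N - (min y N)) * (1.15 ^ ((min y N) - (y - 1)) * 0.86 ^ (min (y - 1) (min y N) + ((min y N) - (r - 1 - (y - 1)))))"
    unfolding N_def by (rule segment_sum_le) (use assms in auto)
  also have "\<dots> \<le> 0.98 ^ (N - (min y N)) * (1.15 ^ 1 * 0.86 ^ (min y r - 2))"
  proof -
    have N: "r \<le> 2 * N + 2" "2 * N + 1 \<le> r" using assms unfolding N_def by linarith+
    have le: "min y r - 2 \<le> min (y - 1) (min y N) + ((min y N) - (r - 1 - (y - 1)))"
    proof (cases "y \<le> N")
      case False
      have *: "k - 2 \<le> N + (N - (r - y))" if "k \<le> y" "k \<le> r" for k
        using that N False by linarith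
      have "(min y N) = N" "min (y - 1) (min y N) = N" "r - 1 - (y - 1) = r - y" using False assms(1) by auto
      then show ?thesis using *[of "min y r"] by (simp only: min.cobounded1 min.cobounded2)
    qed auto
    have A: "(1.15::real) ^ ((min y N) - (y - 1)) \<le> 1.15 ^ 1" by (rule power_increasing) auto
    have B: "(0.86::real) ^ (min (y - 1) (min y N) + ((min y N) - (r - 1 - (y - 1)))) \<le> 0.86 ^ (min y r - 2)"
      by (rule power_decreasing[OF le]) auto
    show ?thesis by (intro mult_left_mono mult_mono A B zero_le_power) auto
  qed
  also have "\<dots> \<le> 0.98 ^ (N - (min y N)) * (1.15 * (0.86 ^ min y r / 0.86 ^ 2))"
    by (intro mult_left_mono mult_mono power_nat_diff_le) auto
  also have "\<dots> = (1.15 / 0.86 ^ 2) * (0.98 ^ (N - (min y N)) * 0.86 ^ min y r)" by simp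
  also have "\<dots> \<le> 2 * (0.98 ^ (N - (min y N)) * 0.86 ^ min y r)"
    by (intro mult_right_mono) (auto simp: power2_eq_square)
  finally show ?thesis by (simp add: N_def)
qed

lemma long_segment_three_letters:
  assumes "1 \<le> y" "1 \<le> r"
  shows "segment_sum (r - 1) 3 y (y - 1) \<le> 3 * 0.998 ^ r"
proof -
  define N where "N = (r - 1) div 2"
  let ?u = "N - min y N"
  have "segment_sum (r - 1) 3 y (y - 1) \<le> 2 * (0.98 ^ ?u * 0.86 ^ min y r)"
    unfolding N_def by (rule long_segment_le) (use assms in auto)
  also have "\<dots> \<le> 2 * ((0.998 ^ 4) ^ ?u * (0.998 ^ 4) ^ min y r)"
    by (intro mult_left_mono mult_mono power_mono) (auto simp: power4_eq_xxxx)
  also have "\<dots> = 2 * 0.998 ^ (4 * ?u + 4 * min y r)"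
    by (simp only: power_mult power_add)
  also have "\<dots> \<le> 2 * 0.998 ^ (r - 2)"
  proof (intro mult_left_mono power_decreasing)
    have "r \<le> 2 * N + 2" "2 * N + 1 \<le> r" using assms unfolding N_def by linarith+
    then show "r - 2 \<le> 4 * ?u + 4 * min y r" by (auto simp: min_def)
  qed auto
  also have "\<dots> \<le> 2 * (0.998 ^ r / 0.998 ^ 2)"
    by (intro mult_left_mono power_nat_diff_le) auto
  also have "\<dots> = (2 / 0.998 ^ 2) * 0.998 ^ r" by simp
  also have "\<dots> \<le> 3 * 0.998 ^ r" by (intro mult_right_mono) (auto simp: power2_eq_square)
  finally show ?thesis .
qed

text \<open>
  Unrestricted starts of chains in the second segment cost a factor 1.15 each. They are paid for by
  the restricted letters of the first segment, since 1.15 * 0.86 < 0.998^4.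
\<close>

lemma segments_four_five_letters:
  assumes "1 \<le> y" "1 \<le> r" "r < m" "K \<in> {4, 5}"
  shows "segment_sum (r - 1) K y (y - 1) * segment_sum (m - 1 - r) (K - 1) y (y - 1 - r) \<le> 4 * 0.998 ^ m"
proof -
  define N M N' M' e where d: "N = (r - 1) div 2" "M = min y N" "N' = (m - 1 - r) div 2" "M' = min y N'" "e = y - 1 - r"
  have K1: "K - 1 \<in> {3, 4, 5}" using assms(4) by auto
  define a u z where a: "a = min y r" "u = N - M + (N' - M')" "z = min e M'"
  have long: "segment_sum (r - 1) K y (y - 1) \<le> 2 * (0.98 ^ (N - M) * 0.86 ^ a)"
    unfolding d a by (rule long_segment_le) (use assms in auto)
  \<comment> \<open>The unrestricted starts of the second segment number at most
    \<open>r + 1\<close>, as \<open>e = y - 1 - r\<close>, and at most \<open>y\<close>. So all but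
    one of them can be matched with the \<open>a\<close> restricted letters of the first segment;
    the spare one makes 2.3 = 2 * 1.15.\<close>
  have M': "M' \<le> y" unfolding d(4) by simp
  then have "M' - e \<le> r + 1" unfolding d(5) by linarith
  then have M'e: "M' - e \<le> a + 1" using M' unfolding a(1) min_def by (split if_split) linarith
  have "segment_sum (m - 1 - r) (K - 1) y e
      \<le> 0.98 ^ (N' - M') * (1.15 ^ (M' - e) * 0.86 ^ (min e M' + (M' - (m - 1 - r - e))))"
    using segment_sum_le[OF assms(1) K1, of M' "m - 1 - r" e] unfolding d(3)[symmetric] d(4) by blast
  also have "\<dots> \<le> 0.98 ^ (N' - M') * (1.15 ^ (a + 1) * 0.86 ^ z)"
  proof -
    have A: "(1.15::real) ^ (M' - e) \<le> 1.15 ^ (a + 1)" by (rule power_increasing[OF M'e]) auto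
    have B: "(0.86::real) ^ (min e M' + (M' - (m - 1 - r - e))) \<le> 0.86 ^ z"
      by (rule power_decreasing) (auto simp: a(3))
    show ?thesis by (intro mult_left_mono mult_mono A B zero_le_power) auto
  qed
  finally have short: "segment_sum (m - 1 - r) (K - 1) y e \<le> 0.98 ^ (N' - M') * (1.15 ^ (a + 1) * 0.86 ^ z)" .
  have "segment_sum (r - 1) K y (y - 1) * segment_sum (m - 1 - r) (K - 1) y e
     \<le> (2 * (0.98 ^ (N - M) * 0.86 ^ a)) * (0.98 ^ (N' - M') * (1.15 ^ (a + 1) * 0.86 ^ z))"
    by (intro mult_mono long short segment_sum_nonneg) auto
  also have "\<dots> = 2.3 * ((0.86 * 1.15) ^ a * 0.86 ^ z * 0.98 ^ u)"
    unfolding a(2) power_add power_mult_distrib by simp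
  also have "\<dots> \<le> 2.3 * ((0.998 ^ 4) ^ a * (0.998 ^ 4) ^ z * (0.998 ^ 4) ^ u)"
    by (intro mult_left_mono mult_mono power_mono) (auto simp: power4_eq_xxxx)
  also have "\<dots> = 2.3 * 0.998 ^ (4 * a + 4 * z + 4 * u)"
    by (simp only: power_mult power_add)
  also have "\<dots> \<le> 2.3 * 0.998 ^ (m - 6)"
  \<comment> \<open>From \<open>N + N' \<le> u + M + M'\<close>, \<open>M \<le> a\<close> and
    \<open>M' \<le> z + a + 1\<close> one gets \<open>m \<le> 2 * u + 4 * a + 2 * z + 6\<close>. The
    coefficient of \<open>a\<close> is the reason for comparing with the fourth power of
    0.998.\<close>
  proof (intro mult_left_mono power_decreasing)
    have "r \<le> 2 * N + 2" "2 * N + 1 \<le> r" unfolding d(1) using assms by linarith+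
    moreover have "m - 1 - r \<le> 2 * N' + 1" unfolding d(3) by linarith
    ultimately have "m \<le> 2 * N + 2 * N' + 4" by linarith
    moreover have "M \<le> a" using \<open>2 * N + 1 \<le> r\<close> unfolding d(2) a(1) by (metis add_leE le_trans min.bounded_iff min.cobounded1 min.cobounded2 mult_2)
    moreover have "M' \<le> z + a + 1" using M'e unfolding a(3) min_def by (split if_split) linarith
    moreover have "N + N' \<le> u + M + M'" unfolding a(2) by linarith
    ultimately show "m - 6 \<le> 4 * a + 4 * z + 4 * u" by linarith
  qed auto
  also have "\<dots> \<le> 2.3 * (0.998 ^ m / 0.998 ^ 6)"
    by (intro mult_left_mono power_nat_diff_le) auto
  also have "\<dots> = (2.3 / 0.998 ^ 6) * 0.998 ^ m" by simp
  also have "\<dots> \<le> 4 * 0.998 ^ m" by (intro mult_right_mono) (auto simp: power_divide)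
  finally show ?thesis unfolding d(5) .
qed

text \<open>The hypotheses on \<open>d\<close> name the quantity in which each range of
  \<open>K\<close> decays: r for 3, where the second segment is critical; m for 4 and 5; the
  Frobenius number (K-1)m + r beyond that.\<close>

lemma segments_le:
  assumes "1 \<le> y" "1 \<le> r" "r < m" "3 \<le> K"
    and d: "K = 3 \<Longrightarrow> d \<le> r" "K \<in> {4, 5} \<Longrightarrow> d \<le> m" "6 \<le> K \<Longrightarrow> d \<le> (K - 1) * m + r"
  shows "tau ^ K * (segment_sum (r - 1) K y (y - 1) * segment_sum (m - 1 - r) (K - 1) y (y - 1 - r))
    \<le> 4 * 0.998 ^ d"
proof -
  let ?P = "segment_sum (r - 1) K y (y - 1) * segment_sum (m - 1 - r) (K - 1) y (y - 1 - r)"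
  have P0: "0 \<le> ?P" by (intro mult_nonneg_nonneg segment_sum_nonneg)
  have t1: "tau ^ K * ?P \<le> ?P"
    using P0 tau_pos tau_less_1 by (intro mult_left_le_one_le) (auto intro: power_le_one)
  consider "K = 3" | "K \<in> {4, 5}" | "6 \<le> K" using assms(4) by force
  then show ?thesis
  proof cases
    case 1
    have "?P \<le> (3 * 0.998 ^ r) * 1"
      unfolding 1 using assms segment_sum_two_letters[of "m - 1 - r" y "y - 1 - r"]
      by (intro mult_mono long_segment_three_letters segment_sum_nonneg) auto
    also have "\<dots> \<le> (3 * 0.998 ^ d) * 1"
      using d(1)[OF 1] by (intro mult_right_mono mult_left_mono power_decreasing) auto
    also have "\<dots> \<le> 4 * 0.998 ^ d" by simp
    finally show ?thesis using t1 by linarith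
  next
    case 2
    have "?P \<le> 4 * 0.998 ^ m" by (rule segments_four_five_letters) (use assms 2 in auto)
    also have "\<dots> \<le> 4 * 0.998 ^ d"
      using d(2)[OF 2] by (intro mult_left_mono power_decreasing) auto
    finally show ?thesis using t1 by linarith
  next
    case 3
    obtain j where K: "K = Suc j" using 3 by (cases K) auto
    obtain r' where r: "r = Suc r'" using assms(2) by (cases r) auto
    obtain n' where n': "m = r + 1 + n'" using less_imp_Suc_add[OF assms(3)] by auto
    have "tau ^ K * ?P \<le> (0.998 ^ 2) ^ K * (0.998 ^ (K * (r - 1)) * 0.998 ^ ((K - 1) * (m - 1 - r)))"
    proof -
      \<comment> \<open>The letter K at r is credited with exponent 2K. This makes up for the K + (K
        - 1) lost by the segment lengths \<open>r - 1\<close> and \<open>m - 1 - r\<close>.\<close>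
      have "tau \<le> 0.998 ^ 2" using tau_bounds by (simp add: power2_eq_square)
      then have A: "tau ^ K \<le> (0.998 ^ 2) ^ K" using tau_pos by (intro power_mono) auto
      have B: "5 \<le> K" "5 \<le> K - 1" using 3 by linarith+
      note C = segment_sum_large_letters[OF assms(1) B(1)] segment_sum_large_letters[OF assms(1) B(2)]
      show ?thesis
        by (rule mult_mono[OF A mult_mono[OF C]])
          (simp_all only: segment_sum_nonneg mult_nonneg_nonneg zero_le_power zero_le_divide_iff zero_le_numeral simp_thms)
    qed
    also have "\<dots> = 0.998 ^ (2 * K + (K * (r - 1) + (K - 1) * (m - 1 - r)))"
      by (simp only: power_mult power_add)
    also have "\<dots> \<le> 0.998 ^ d"
    proof (rule power_decreasing)
      have "(K - 1) * m + r \<le> 2 * K + (K * (r - 1) + (K - 1) * (m - 1 - r))"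
        unfolding K r n' by (simp add: algebra_simps)
      then show "d \<le> 2 * K + (K * (r - 1) + (K - 1) * (m - 1 - r))" using d(3)[OF 3] by linarith
    qed auto
    also have "\<dots> \<le> 4 * 0.998 ^ d" by simp
    finally show ?thesis .
  qed
qed

section \<open>Kunz words\<close>

definition semigroup_mult :: "nat set \<Rightarrow> nat" where
  "semigroup_mult S = (LEAST n. 0 < n \<and> n \<in> S)"

definition frobenius :: "nat set \<Rightarrow> nat" where
  "frobenius S = Max (UNIV - S)"

text \<open>A least quotient, so that membership is read off directly; that it counts gaps for 0 < c
  < m is contained in \<open>gaps_eq\<close>. The argument need not be reduced modulo m.\<close>

definition kunz :: "nat set \<Rightarrow> nat \<Rightarrow> nat" where
  "kunz S c = (LEAST q. q * semigroup_mult S + c \<in> S)"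

text \<open>If no letter is 1, the shift is the multiplicity and imposes no condition.\<close>

definition kunz_shift :: "nat set \<Rightarrow> nat" where
  "kunz_shift S = Min (insert (semigroup_mult S) {c \<in> {1..<semigroup_mult S}. kunz S c = 1})"

locale num_semigroup =
  fixes S :: "nat set" and m :: nat
  assumes semigroup: "numerical_semigroup S"
  defines "m \<equiv> semigroup_mult S"
begin

lemma zero_mem: "0 \<in> S" and add_mem: "a \<in> S \<Longrightarrow> b \<in> S \<Longrightarrow> a + b \<in> S"
  and finite_gaps: "finite (UNIV - S)"
  using semigroup by (auto simp: numerical_semigroup_def)

lemma ex_large_mem: "\<exists>N. \<forall>n\<ge>N. n \<in> S"
proof -
  obtain N where "\<forall>x\<in>UNIV - S. x < N"
    using finite_gaps finite_nat_set_iff_bounded by blast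
  then show ?thesis by (metis DiffI UNIV_I not_less)
qed

lemma mult_pos: "0 < m" and mult_mem: "m \<in> S"
proof -
  obtain N where "\<forall>n\<ge>N. n \<in> S" using ex_large_mem by blast
  then have "0 < Suc N \<and> Suc N \<in> S" by auto
  from LeastI[of "\<lambda>n. 0 < n \<and> n \<in> S", OF this]
  show "0 < m" "m \<in> S" by (auto simp: m_def semigroup_mult_def)
qed

lemma less_mult_not_mem: "0 < x \<Longrightarrow> x < m \<Longrightarrow> x \<notin> S"
  unfolding m_def semigroup_mult_def using not_less_Least by blast

lemma mult_multiple_mem: "a \<in> S \<Longrightarrow> q * m + a \<in> S"
  by (induction q) (auto simp: add.assoc intro: add_mem mult_mem)

text \<open>Adding m preserves S, so S meets each residue class in a final segment. Every inequality
  between letters below comes from this equivalence.\<close>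

lemma mem_iff_kunz: "q * m + c \<in> S \<longleftrightarrow> kunz S c \<le> q"
proof -
  obtain N where N: "\<forall>n\<ge>N. n \<in> S" using ex_large_mem by blast
  have "N \<le> N * m + c" using mult_pos by (simp add: trans_le_add1)
  then have k: "kunz S c * m + c \<in> S"
    unfolding kunz_def m_def[symmetric] using N by (intro LeastI[of "\<lambda>q. q * m + c \<in> S" N]) auto
  show ?thesis
  proof
    assume "kunz S c \<le> q"
    then have "q * m + c = (q - kunz S c) * m + (kunz S c * m + c)"
      by (simp add: diff_mult_distrib)
    then show "q * m + c \<in> S" by (simp only: mult_multiple_mem[OF k])
  qed (auto simp: kunz_def m_def[symmetric] intro: Least_le)
qed

lemma kunz_pos: "1 \<le> c \<Longrightarrow> c < m \<Longrightarrow> 1 \<le> kunz S c"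
  using mem_iff_kunz[of 0 c] less_mult_not_mem[of c] by auto

lemma kunz_add: "kunz S (a + b) \<le> kunz S a + kunz S b"
proof -
  have "kunz S a * m + a \<in> S" "kunz S b * m + b \<in> S" using mem_iff_kunz by auto
  from add_mem[OF this] have "(kunz S a + kunz S b) * m + (a + b) \<in> S"
    by (simp add: algebra_simps)
  then show ?thesis using mem_iff_kunz by blast
qed

lemma kunz_add_wrap: "a + b = m + c \<Longrightarrow> kunz S c \<le> kunz S a + kunz S b + 1"
proof -
  assume e: "a + b = m + c"
  have "kunz S a * m + a \<in> S" "kunz S b * m + b \<in> S" using mem_iff_kunz by auto
  from add_mem[OF this] have "(kunz S a + kunz S b) * m + (a + b) \<in> S"
    by (simp add: algebra_simps)
  then have "(kunz S a + kunz S b + 1) * m + c \<in> S" unfolding e by (simp add: algebra_simps)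
  then show ?thesis using mem_iff_kunz by blast
qed

lemma gaps_eq: "UNIV - S = (\<lambda>(c, q). q * m + c) ` (SIGMA c:{1..<m}. {..<kunz S c})"
proof (intro equalityI subsetI)
  fix x assume x: "x \<in> UNIV - S"
  have e: "x div m * m + x mod m = x" by simp
  have "x mod m \<noteq> 0"
  proof
    assume "x mod m = 0"
    then have "x = x div m * m + 0" using e by simp
    then show False using mult_multiple_mem[OF zero_mem, of "x div m"] x by auto
  qed
  moreover have "x div m < kunz S (x mod m)"
    using mem_iff_kunz[of "x div m" "x mod m"] x e by auto
  ultimately show "x \<in> (\<lambda>(c, q). q * m + c) ` (SIGMA c:{1..<m}. {..<kunz S c})"
    using mult_pos e by (intro image_eqI[of _ _ "(x mod m, x div m)"]) auto
qed (use mem_iff_kunz in force)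

lemma genus_eq_sum: "genus S = (\<Sum>c\<in>{1..<m}. kunz S c)"
proof -
  have "inj_on (\<lambda>(c, q). q * m + c) (SIGMA c:{1..<m}. {..<kunz S c})"
  proof (rule inj_onI, clarify)
    fix c q c' q' assume a: "c \<in> {1..<m}" "c' \<in> {1..<m}" and e: "q * m + c = q' * m + c'"
    have "(q * m + c) mod m = c" "(q' * m + c') mod m = c'" using a by auto
    moreover have "(q * m + c) div m = q" "(q' * m + c') div m = q'" using a by auto
    ultimately show "c = c' \<and> q = q'" using e by metis
  qed
  then show ?thesis unfolding genus_def gaps_eq by (simp add: card_image)
qed

lemma kunz_le_genus: "c \<in> {1..<m} \<Longrightarrow> kunz S c \<le> genus S"
  unfolding genus_eq_sum by (rule member_le_sum) auto

lemma mult_le_genus: "m \<le> genus S + 1"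
proof -
  have "(\<Sum>c\<in>{1..<m}. 1) \<le> genus S"
    unfolding genus_eq_sum by (intro sum_mono) (use kunz_pos in auto)
  then show ?thesis by simp
qed

text \<open>A crude quadratic bound that serves the finiteness of
  \<open>semigroups_of_genus\<close>.\<close>

lemma gap_bound: "x \<notin> S \<Longrightarrow> x < (genus S + 1) * (genus S + 1)"
proof -
  assume "x \<notin> S"
  then obtain c q where cq: "c \<in> {1..<m}" "q < kunz S c" "x = q * m + c"
    using gaps_eq by fastforce
  have "q < genus S" using cq kunz_le_genus[of c] by simp
  then have "x < (q + 1) * m" "q + 1 \<le> genus S + 1" using cq by auto
  then show ?thesis using mult_le_genus by (meson less_le_trans mult_le_mono)
qed

lemma kunz_shift_properties:
  shows "1 \<le> kunz_shift S" "kunz_shift S \<le> m"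
    and "1 \<le> c \<Longrightarrow> c < kunz_shift S \<Longrightarrow> 2 \<le> kunz S c"
    and "1 \<le> c \<Longrightarrow> c + kunz_shift S < m \<Longrightarrow> kunz S c = 1 \<Longrightarrow> kunz S (c + kunz_shift S) \<le> 2"
proof -
  let ?A = "insert m {c \<in> {1..<m}. kunz S c = 1}"
  have y: "kunz_shift S = Min ?A" by (simp add: kunz_shift_def m_def)
  have yA: "kunz_shift S \<in> ?A" unfolding y by (rule Min_in) auto
  have le: "kunz_shift S \<le> c" if "c \<in> ?A" for c unfolding y by (rule Min_le) (use that in auto)
  show "1 \<le> kunz_shift S" using yA mult_pos by auto
  show ym: "kunz_shift S \<le> m" by (rule le) simp
  show "2 \<le> kunz S c" if "1 \<le> c" "c < kunz_shift S"
  proof -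
    have "c < m" using that ym by simp
    moreover have "c \<notin> ?A" using le[of c] that by auto
    ultimately show ?thesis using kunz_pos[of c] that by auto
  qed
  show "kunz S (c + kunz_shift S) \<le> 2" if "1 \<le> c" "c + kunz_shift S < m" "kunz S c = 1"
  proof -
    \<comment> \<open>\<open>c + kunz_shift S < m\<close> excludes the default value m, so the shift
      is a true position of a letter 1.\<close>
    have "kunz S (kunz_shift S) = 1" using yA that by auto
    then show ?thesis using kunz_add[of c "kunz_shift S"] that by simp
  qed
qed

text \<open>F is a gap and everything above it lies in S. Since K m + c > F for all c, and (K - 1) m
  + c > F already for c > r, the letters are at most K before r and at most K - 1 after r.\<close>

lemma frobenius_properties:
  assumes "UNIV - S \<noteq> {}" "K = frobenius S div m + 1" "r = frobenius S mod m"
  shows "frobenius S = (K - 1) * m + r" "1 \<le> r" "r < m" "kunz S r = K"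
    and "c \<in> {1..<r} \<Longrightarrow> kunz S c \<le> K" "c \<in> {r<..<m} \<Longrightarrow> kunz S c \<le> K - 1"
    and "genus S \<le> frobenius S"
proof -
  have F: "frobenius S \<notin> S" using Max_in[OF finite_gaps assms(1)] by (simp add: frobenius_def)
  have big: "x \<in> S" if "frobenius S < x" for x
    using Max_ge[OF finite_gaps, of x] that by (force simp: frobenius_def)
  show e: "frobenius S = (K - 1) * m + r" using assms by simp
  show r: "r < m" using assms mult_pos by simp
  have "r \<noteq> 0"
  proof
    assume "r = 0"
    then show False using F e mult_multiple_mem[OF zero_mem, of "K - 1"] by simp
  qed
  then show "1 \<le> r" by simp
  have "\<not> kunz S r \<le> K - 1" using F mem_iff_kunz[of "K - 1" r] e by simp
  moreover obtain j where j: "K = Suc j" using assms(2) by auto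
  have Km: "frobenius S < K * m" unfolding e using r by (simp add: j)
  then have "K * m + r \<in> S" by (intro big) linarith
  then have "kunz S r \<le> K" using mem_iff_kunz by blast
  ultimately show "kunz S r = K" by simp
  show "kunz S c \<le> K" if "c \<in> {1..<r}"
    using mem_iff_kunz[of K c] big[of "K * m + c"] Km by simp
  show "kunz S c \<le> K - 1" if "c \<in> {r<..<m}"
    using mem_iff_kunz[of "K - 1" c] big[of "(K - 1) * m + c"] e that by simp
  have "UNIV - S \<subseteq> {1..frobenius S}"
    using big zero_mem by (force simp: not_less[symmetric] Suc_le_eq intro: gr0I)
  then have "card (UNIV - S) \<le> card {1..frobenius S}" by (intro card_mono) auto
  then show "genus S \<le> frobenius S" by (simp add: genus_def)
qed

lemma mem_iff_mod: "x \<in> S \<longleftrightarrow> x mod m = 0 \<or> kunz S (x mod m) \<le> x div m"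
proof (cases "x mod m = 0")
  case True
  then have "x = x div m * m + 0" by auto
  then show ?thesis using True mult_multiple_mem[OF zero_mem, of "x div m"] by simp
next
  case False
  then show ?thesis using mem_iff_kunz[of "x div m" "x mod m"] by simp
qed

end

section \<open>Counting semigroups by type\<close>

lemma numerical_semigroup_eqI:
  assumes "numerical_semigroup S" "numerical_semigroup S'" "semigroup_mult S = semigroup_mult S'"
    and "\<And>c. 1 \<le> c \<Longrightarrow> c < semigroup_mult S \<Longrightarrow> kunz S c = kunz S' c"
  shows "S = S'"
proof -
  interpret A: num_semigroup S "semigroup_mult S" using assms by unfold_locales
  interpret B: num_semigroup S' "semigroup_mult S'" using assms by unfold_locales
  have "x \<in> S \<longleftrightarrow> x \<in> S'" for x
    unfolding A.mem_iff_mod B.mem_iff_mod assms(3)[symmetric]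
    using assms(4)[of "x mod semigroup_mult S"] A.mult_pos by (cases "x mod semigroup_mult S = 0") auto
  then show ?thesis by blast
qed

lemma finite_semigroups_of_genus [simp]: "finite (semigroups_of_genus g)"
proof (rule finite_subset)
  show "semigroups_of_genus g \<subseteq> (\<lambda>G. UNIV - G) ` Pow {..<(g + 1) * (g + 1)}"
  proof
    fix S assume "S \<in> semigroups_of_genus g"
    then have S: "numerical_semigroup S" "genus S = g" by (auto simp: semigroups_of_genus_def)
    interpret num_semigroup S "semigroup_mult S" using S by unfold_locales
    have "UNIV - S \<in> Pow {..<(g + 1) * (g + 1)}" using gap_bound S by auto
    then show "S \<in> (\<lambda>G. UNIV - G) ` Pow {..<(g + 1) * (g + 1)}" by (intro image_eqI[of _ _ "UNIV - S"]) auto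
  qed
qed auto

text \<open>The letter at r is K throughout the type, so S is determined by the two segments and the
  weight \<open>tau ^ g\<close> factors over them. The initial run of letters at least 2 reaches
  into the second segment if y > r + 1, which gives its last argument
  \<open>y - 1 - r\<close>.\<close>

lemma card_semigroups_by_type:
  fixes g m K r y :: nat
  assumes r: "1 \<le> r" "r < m" and K: "1 \<le> K" and g: "1 \<le> g"
  defines "A \<equiv> {S \<in> semigroups_of_genus g. semigroup_mult S = m \<and>
     frobenius S = (K - 1) * m + r \<and> kunz_shift S = y}"
  shows "real (card A) * tau ^ g \<le>
     tau ^ K * (segment_sum (r - 1) K y (y - 1) * segment_sum (m - 1 - r) (K - 1) y (y - 1 - r))"
proof -
  define L where "L = segment_words (r - 1) K y (y - 1)"
  define L' where "L' = segment_words (m - 1 - r) (K - 1) y (y - 1 - r)"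
  define h where "h = (\<lambda>S. (\<lambda>i\<in>{1..r - 1}. kunz S i, \<lambda>i\<in>{1..m - 1 - r}. kunz S (r + i)))"
  define f where "f = (\<lambda>(u, v). tau ^ K * ((\<Prod>i\<in>{1..r - 1}. tau ^ u i) * (\<Prod>i\<in>{1..m - 1 - r}. tau ^ v i)) :: real)"
  have A: "numerical_semigroup S" "genus S = g" "semigroup_mult S = m" "kunz_shift S = y"
     "kunz S r = K" "\<And>c. c \<in> {1..<r} \<Longrightarrow> kunz S c \<le> K" "\<And>c. c \<in> {r<..<m} \<Longrightarrow> kunz S c \<le> K - 1"
     if "S \<in> A" for S
  proof -
    show S: "numerical_semigroup S" "genus S = g" "semigroup_mult S = m" "kunz_shift S = y"
      using that by (auto simp: A_def semigroups_of_genus_def)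
    interpret num_semigroup S m by unfold_locales (use S in auto)
    have ne: "UNIV - S \<noteq> {}" using S(2) g by (metis card.empty genus_def not_one_le_zero)
    have F: "frobenius S = (K - 1) * m + r" using that by (simp add: A_def)
    have e: "K = frobenius S div m + 1" "r = frobenius S mod m" using F r K by auto
    show "kunz S r = K" "\<And>c. c \<in> {1..<r} \<Longrightarrow> kunz S c \<le> K" "\<And>c. c \<in> {r<..<m} \<Longrightarrow> kunz S c \<le> K - 1"
      using frobenius_properties[OF ne e] by blast+
  qed
  have split: "{1..<m} = insert r ({1..r - 1} \<union> {r + 1..m - 1})" using r by auto
  have "real (card A) * tau ^ g = (\<Sum>S\<in>A. tau ^ g)" by simp
  also have "\<dots> \<le> (\<Sum>z\<in>L \<times> L'. f z)"
  proof (rule sum_le_sum_inj_on[of h])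
    show "inj_on h A"
    proof (rule inj_onI)
      fix S S' assume S: "S \<in> A" "S' \<in> A" and e: "h S = h S'"
      have e1: "kunz S i = kunz S' i" if "i \<in> {1..r - 1}" for i
        using fun_cong[OF arg_cong[OF e, of fst], of i] that by (simp add: h_def)
      have e2: "kunz S (r + i) = kunz S' (r + i)" if "i \<in> {1..m - 1 - r}" for i
        using fun_cong[OF arg_cong[OF e, of snd], of i] that by (simp add: h_def)
      show "S = S'"
      proof (rule numerical_semigroup_eqI)
        fix c assume c: "1 \<le> c" "c < semigroup_mult S"
        consider "c \<in> {1..r - 1}" | "c = r" | "c - r \<in> {1..m - 1 - r}" "c = r + (c - r)"
          using c A(3)[OF S(1)] by fastforce
        then show "kunz S c = kunz S' c"
          using e1 e2 A(5) S by cases metis+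
      qed (use A S in auto)
    qed
    show "h ` A \<subseteq> L \<times> L'"
    proof (rule image_subsetI)
      fix S assume S: "S \<in> A"
      interpret num_semigroup S m by unfold_locales (use A[OF S] in auto)
      note y = kunz_shift_properties[unfolded A(4)[OF S]]
      have "fst (h S) \<in> L"
        unfolding L_def segment_words_def
      proof (intro CollectI conjI ballI allI impI)
        show "fst (h S) \<in> {1..r - 1} \<rightarrow>\<^sub>E {1..K}"
          using A(6)[OF S] kunz_pos r by (auto simp: h_def)
        show "K \<le> fst (h S) i + fst (h S) (r - 1 + 1 - i)" if "i \<in> {1..r - 1}" for i
        proof -
          have "r - 1 + 1 - i \<in> {1..r - 1}" "i + (r - 1 + 1 - i) = r" using that by auto
          then show ?thesis using kunz_add[of i "r - 1 + 1 - i"] A(5)[OF S] that by (simp add: h_def)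
        qed
        show "fst (h S) (i + y) \<le> 2" if "1 \<le> i \<and> i + y \<le> r - 1 \<and> fst (h S) i = 1" for i
        proof -
          have "i \<in> {1..r - 1}" "i + y \<in> {1..r - 1}" "i + y < m" using that r by auto
          then have "fst (h S) i = kunz S i" "fst (h S) (i + y) = kunz S (i + y)" by (simp_all add: h_def)
          moreover have "1 \<le> i" "fst (h S) i = 1" using that by auto
          ultimately show ?thesis using y(4)[of i] \<open>i + y < m\<close> by metis
        qed
        show "2 \<le> fst (h S) i" if "i \<in> {1..r - 1}" "i \<le> y - 1" for i
        proof -
          have "i < y" using that by auto
          then show ?thesis using y(3)[of i] that by (simp add: h_def)
        qed
      qed
      moreover have "snd (h S) \<in> L'"
        unfolding L'_def segment_words_def
      proof (intro CollectI conjI ballI allI impI)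
        show "snd (h S) \<in> {1..m - 1 - r} \<rightarrow>\<^sub>E {1..K - 1}"
          using A(7)[OF S] kunz_pos r by (auto simp: h_def)
        show "K - 1 \<le> snd (h S) i + snd (h S) (m - 1 - r + 1 - i)" if "i \<in> {1..m - 1 - r}" for i
        proof -
          have "m - 1 - r + 1 - i \<in> {1..m - 1 - r}" "(r + i) + (r + (m - 1 - r + 1 - i)) = m + r"
            using that by auto
          then show ?thesis using kunz_add_wrap[of "r + i" "r + (m - 1 - r + 1 - i)" r] A(5)[OF S] that
            by (simp add: h_def)
        qed
        show "snd (h S) (i + y) \<le> 2" if "1 \<le> i \<and> i + y \<le> m - 1 - r \<and> snd (h S) i = 1" for i
        proof -
          have "i \<in> {1..m - 1 - r}" "i + y \<in> {1..m - 1 - r}" "r + i + y < m" "1 \<le> r + i" using that r by auto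
          then have "snd (h S) i = kunz S (r + i)" "snd (h S) (i + y) = kunz S (r + i + y)"
            by (simp_all add: h_def add.assoc)
          moreover have "snd (h S) i = 1" using that by auto
          ultimately show ?thesis using y(4)[of "r + i"] \<open>r + i + y < m\<close> \<open>1 \<le> r + i\<close> by metis
        qed
        show "2 \<le> snd (h S) i" if "i \<in> {1..m - 1 - r}" "i \<le> y - 1 - r" for i
        proof -
          have "r + i < y" using that by auto
          then show ?thesis using y(3)[of "r + i"] that by (simp add: h_def)
        qed
      qed
      ultimately show "h S \<in> L \<times> L'" by (simp add: mem_Times_iff)
    qed
    show "finite (L \<times> L')" by (simp add: L_def L'_def)
    show "0 \<le> f z" for z
      using tau_pos by (auto simp: f_def case_prod_unfold intro!: mult_nonneg_nonneg prod_nonneg)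
    show "tau ^ g \<le> f (h S)" if S: "S \<in> A" for S
    proof -
      interpret num_semigroup S m by unfold_locales (use A[OF S] in auto)
      have "tau ^ g = (\<Prod>c\<in>{1..<m}. tau ^ kunz S c)"
        using genus_eq_sum A(2)[OF S] by (simp add: power_sum)
      also have "\<dots> = tau ^ K * ((\<Prod>c\<in>{1..r - 1}. tau ^ kunz S c) * (\<Prod>c\<in>{r + 1..m - 1}. tau ^ kunz S c))"
        unfolding split using r A(5)[OF S] by (subst prod.insert) (auto simp: prod.union_disjoint)
      also have "(\<Prod>c\<in>{r + 1..m - 1}. tau ^ kunz S c) = (\<Prod>i\<in>{1..m - 1 - r}. tau ^ kunz S (r + i))"
        by (rule prod.reindex_bij_witness[of _ "\<lambda>i. r + i" "\<lambda>c. c - r"]) auto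
      also have "tau ^ K * ((\<Prod>c\<in>{1..r - 1}. tau ^ kunz S c) * (\<Prod>i\<in>{1..m - 1 - r}. tau ^ kunz S (r + i))) = f (h S)"
        by (simp add: f_def h_def)
      finally show ?thesis by simp
    qed
  qed
  also have "\<dots> = tau ^ K * (segment_sum (r - 1) K y (y - 1) * segment_sum (m - 1 - r) (K - 1) y (y - 1 - r))"
    unfolding f_def segment_sum_def L_def L'_def sum.cartesian_product[symmetric]
    unfolding sum_product by (simp only: sum_distrib_left)
  finally show ?thesis .
qed

text \<open>At most (g + 2)^4 types occur. For K = 3, F = 2m + r gives r > d. For K at most 5, F <
  5m, and as F is at least the genus, \<open>5 * d \<le> g\<close> gives m >= d.\<close>

lemma card_large_frobenius:
  assumes "1 \<le> g" "5 * d \<le> g"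
  shows "real (card {S \<in> semigroups_of_genus g. 2 * semigroup_mult S + d < frobenius S}) * tau ^ g
    \<le> 4 * real (g + 2) ^ 4 * 0.998 ^ d"
proof -
  define B where "B = {S \<in> semigroups_of_genus g. 2 * semigroup_mult S + d < frobenius S}"
  define h where "h = (\<lambda>S. (semigroup_mult S, frobenius S div semigroup_mult S, frobenius S mod semigroup_mult S, kunz_shift S))"
  define T where "T = {..g + 1} \<times> {..g + 1} \<times> {..g + 1} \<times> {..g + 1}"
  have B: "semigroup_mult S \<le> g + 1" "kunz_shift S \<le> g + 1" "frobenius S div semigroup_mult S + 1 \<le> g"
     "frobenius S = frobenius S div semigroup_mult S * semigroup_mult S + frobenius S mod semigroup_mult S"
     "1 \<le> frobenius S mod semigroup_mult S" "frobenius S mod semigroup_mult S < semigroup_mult S"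
     "g \<le> frobenius S" "2 * semigroup_mult S + d < frobenius S" "1 \<le> kunz_shift S" if "S \<in> B" for S
  proof -
    have S: "numerical_semigroup S" "genus S = g" using that by (auto simp: B_def semigroups_of_genus_def)
    interpret num_semigroup S "semigroup_mult S" using S by unfold_locales
    have ne: "UNIV - S \<noteq> {}" using S(2) assms(1) by (metis card.empty genus_def not_one_le_zero)
    note F = frobenius_properties[OF ne refl refl]
    show "semigroup_mult S \<le> g + 1" using mult_le_genus S by simp
    then show "kunz_shift S \<le> g + 1" "1 \<le> kunz_shift S" using kunz_shift_properties(1,2) by auto
    show "frobenius S div semigroup_mult S + 1 \<le> g" 
      using kunz_le_genus[of "frobenius S mod semigroup_mult S"] F(2,3,4) S(2) by simp
    show "1 \<le> frobenius S mod semigroup_mult S" "frobenius S mod semigroup_mult S < semigroup_mult S"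
      "g \<le> frobenius S" using F S by auto
    show "2 * semigroup_mult S + d < frobenius S" using that by (simp add: B_def)
  qed simp
  have bound: "real (card {S \<in> B. h S = z}) * tau ^ g \<le> 4 * 0.998 ^ d" for z
  proof (cases "{S \<in> B. h S = z} = {}")
    case False
    then obtain S where S: "S \<in> B" "h S = z" by blast
    obtain m q r y where z: "z = (m, q, r, y)" by (metis prod_cases4)
    have e: "semigroup_mult S = m" "frobenius S div m = q" "frobenius S mod m = r" "kunz_shift S = y"
      using S z by (auto simp: h_def)
    note b = B[OF S(1), unfolded e]
    define K where "K = q + 1"
    have q2: "2 \<le> q"
    proof (rule ccontr)
      assume "\<not> 2 \<le> q"
      then have "q \<le> 1" by simp
      then have "q * m \<le> 1 * m" by (rule mult_le_mono1)
      then show False using b by linarith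
    qed
    have "{S \<in> B. h S = z} \<subseteq> {S \<in> semigroups_of_genus g. semigroup_mult S = m \<and>
        frobenius S = (K - 1) * m + r \<and> kunz_shift S = y}"
      using z by (auto simp: h_def B_def K_def)
    then have "card {S \<in> B. h S = z} \<le> card {S \<in> semigroups_of_genus g. semigroup_mult S = m \<and>
        frobenius S = (K - 1) * m + r \<and> kunz_shift S = y}" by (intro card_mono) auto
    then have "real (card {S \<in> B. h S = z}) * tau ^ g \<le> real (card {S \<in> semigroups_of_genus g. semigroup_mult S = m \<and>
        frobenius S = (K - 1) * m + r \<and> kunz_shift S = y}) * tau ^ g"
      using tau_pos by (intro mult_right_mono) auto
    also have "\<dots> \<le> tau ^ K * (segment_sum (r - 1) K y (y - 1) * segment_sum (m - 1 - r) (K - 1) y (y - 1 - r))"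
      by (rule card_semigroups_by_type) (use b assms in \<open>auto simp: K_def\<close>)
    also have "\<dots> \<le> 4 * 0.998 ^ d"
    proof (rule segments_le)
      show "1 \<le> y" "1 \<le> r" "r < m" "3 \<le> K" using b q2 by (auto simp: K_def)
      show "d \<le> r" if "K = 3"
      proof -
        have "q = 2" using that by (simp add: K_def)
        then show ?thesis using b by simp
      qed
      show "d \<le> m" if "K \<in> {4, 5}"
      proof -
        have "q \<le> 4" using that by (auto simp: K_def)
        then have "q * m \<le> 4 * m" by (rule mult_le_mono1)
        then show ?thesis using b assms(2) by linarith
      qed
      show "d \<le> (K - 1) * m + r" using b(4,8) by (simp add: K_def)
    qed
    finally show ?thesis .
  next
    case True
    then have "card {S \<in> B. h S = z} = 0" by (simp only: card.empty)
    then show ?thesis by simp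
  qed
  have hT: "h ` B \<subseteq> T"
  proof (rule image_subsetI)
    fix S assume "S \<in> B"
    from B(1-3,6)[OF this] show "h S \<in> T" by (auto simp: h_def T_def)
  qed
  have finB: "finite B" by (simp add: B_def)
  have finT: "finite T" by (simp add: T_def)
  have "B = (\<Union>z\<in>T. {S \<in> B. h S = z})" using hT by auto
  then have "card B = card (\<Union>z\<in>T. {S \<in> B. h S = z})" by simp
  also have "\<dots> \<le> (\<Sum>z\<in>T. card {S \<in> B. h S = z})" by (rule card_UN_le[OF finT])
  finally have "real (card B) \<le> real (\<Sum>z\<in>T. card {S \<in> B. h S = z})"
    by (rule of_nat_mono)
  then have "real (card B) * tau ^ g \<le> (\<Sum>z\<in>T. real (card {S \<in> B. h S = z}) * tau ^ g)"
    using tau_pos unfolding sum_distrib_right[symmetric] of_nat_sum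
    by (intro mult_right_mono) auto
  also have "\<dots> \<le> (\<Sum>z\<in>T. 4 * 0.998 ^ d)" by (intro sum_mono bound)
  also have "\<dots> = 4 * real (g + 2) ^ 4 * 0.998 ^ d"
    by (simp add: T_def card_cartesian_product power4_eq_xxxx algebra_simps)
  finally show ?thesis by (simp add: B_def)
qed

section \<open>Semigroups with small Frobenius number\<close>

text \<open>F is at most 2m + d, phrased without the maximum of a possibly empty set of
  gaps.\<close>

definition tail_from :: "nat \<Rightarrow> nat set \<Rightarrow> bool" where
  "tail_from d S \<longleftrightarrow> (\<forall>x>2 * semigroup_mult S + d. x \<in> S)"

definition free_interval :: "nat \<Rightarrow> nat set \<Rightarrow> nat set" where
  "free_interval d S = {semigroup_mult S + d<..<2 * semigroup_mult S}"

lemma finite_free_interval [simp]: "finite (free_interval d S)"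
  by (simp add: free_interval_def)

lemma card_free_interval: "card (free_interval d S) = semigroup_mult S - 1 - d"
  by (simp add: free_interval_def)

lemma semigroup_mult_eqI:
  assumes "0 < m" "m \<in> S" "\<And>x. 0 < x \<Longrightarrow> x < m \<Longrightarrow> x \<notin> S"
  shows "semigroup_mult S = m"
  unfolding semigroup_mult_def by (rule Least_equality) (use assms in \<open>auto simp: not_less[symmetric]\<close>)

context num_semigroup
begin

lemma mem_ge_mult: "a \<in> S \<Longrightarrow> a = 0 \<or> m \<le> a"
  using less_mult_not_mem[of a] by force

text \<open>Two nonzero elements have a sum of at least 2m, which is outside the interval. If one of
  them lies in the interval, the sum exceeds 2m + d, where everything belongs to S.\<close>

lemma refill_free_interval:
  assumes d: "d < m" and tail: "tail_from d S" and T: "T \<subseteq> free_interval d S"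
  defines "S' \<equiv> (S - free_interval d S) \<union> T"
  shows "numerical_semigroup S'" "semigroup_mult S' = m" "tail_from d S'"
    "S' - free_interval d S = S - free_interval d S" "S' \<inter> free_interval d S = T"
    "genus S' = card (UNIV - S - free_interval d S) + card (free_interval d S - T)"
proof -
  let ?I = "free_interval d S"
  have I: "x \<in> ?I \<longleftrightarrow> m + d < x \<and> x < 2 * m" for x by (auto simp: free_interval_def m_def)
  have tail': "x \<in> S" if "2 * m + d < x" for x using tail that by (auto simp: tail_from_def m_def)
  have ge: "a = 0 \<or> m \<le> a" if "a \<in> S'" for a
    using that mem_ge_mult[of a] T I by (auto simp: S'_def)
  show num: "numerical_semigroup S'"
    unfolding numerical_semigroup_def
  proof (intro conjI ballI)
    show "0 \<in> S'" using zero_mem I by (auto simp: S'_def)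
    fix a b assume ab: "a \<in> S'" "b \<in> S'"
    show "a + b \<in> S'"
    proof (cases "a = 0 \<or> b = 0")
      case False
      then have le: "m \<le> a" "m \<le> b" using ge ab by auto
      then have "a + b \<notin> ?I" using I by auto
      moreover have "a + b \<in> S"
      proof (cases "a \<in> T \<or> b \<in> T")
        case True
        then have "2 * m + d < a + b" using le T I by (auto simp: subset_iff)
        then show ?thesis by (rule tail')
      next
        case False
        then show ?thesis using ab by (auto simp: S'_def intro: add_mem)
      qed
      ultimately show ?thesis by (simp add: S'_def)
    qed (use ab in auto)
  next
    show "finite (UNIV - S')"
      by (rule finite_subset[of _ "(UNIV - S) \<union> ?I"]) (use finite_gaps in \<open>auto simp: S'_def\<close>)
  qed
  have "m \<notin> ?I" using I by simp
  show mult: "semigroup_mult S' = m"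
  proof (rule semigroup_mult_eqI)
    show "m \<in> S'" using mult_mem \<open>m \<notin> ?I\<close> by (simp add: S'_def)
  qed (use ge mult_pos in \<open>auto simp: not_less[symmetric]\<close>)
  show "tail_from d S'" unfolding tail_from_def mult using tail' I by (auto simp: S'_def)
  show "S' - ?I = S - ?I" using T by (auto simp: S'_def)
  show "S' \<inter> ?I = T" using T by (auto simp: S'_def)
  have "UNIV - S' = (UNIV - S - ?I) \<union> (?I - T)" using T by (auto simp: S'_def)
  moreover have "finite (UNIV - S - ?I)" using finite_gaps by (rule finite_subset[rotated]) auto
  ultimately show "genus S' = card (UNIV - S - ?I) + card (?I - T)"
    unfolding genus_def by (subst card_Un_disjoint[symmetric]) auto
qed

text \<open>Apart from 1, ..., m - 1 and the free interval, gaps can occur only in the two windows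
  of length \<open>d\<close> after m and 2m.\<close>

lemma genus_free_interval:
  assumes tail: "tail_from d S"
  shows "m - 1 + card (free_interval d S - S) \<le> genus S"
    and "genus S \<le> m - 1 + 2 * d + card (free_interval d S - S)"
proof -
  let ?I = "free_interval d S"
  have I: "x \<in> ?I \<longleftrightarrow> m + d < x \<and> x < 2 * m" for x by (auto simp: free_interval_def m_def)
  have tail': "x \<in> S" if "2 * m + d < x" for x using tail that by (auto simp: tail_from_def m_def)
  have "card ({1..<m} \<union> (?I - S)) = m - 1 + card (?I - S)"
    by (subst card_Un_disjoint) (auto simp: I)
  moreover have "card ({1..<m} \<union> (?I - S)) \<le> card (UNIV - S)"
    using finite_gaps less_mult_not_mem by (intro card_mono) auto
  ultimately show "m - 1 + card (?I - S) \<le> genus S" by (simp add: genus_def)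
  have "m * 1 + m \<in> S" using mult_mem by (intro add_mem) auto
  then have m2: "2 * m \<in> S" by (simp add: mult_2)
  have "UNIV - S \<subseteq> {1..<m} \<union> {m<..m + d} \<union> {2 * m<..2 * m + d} \<union> (?I - S)"
  proof
    fix x assume "x \<in> UNIV - S"
    then have x: "x \<notin> S" by simp
    then have "x \<noteq> 0" "x \<noteq> m" "x \<noteq> 2 * m" "\<not> 2 * m + d < x"
      using zero_mem mult_mem m2 tail'[of x] by metis+
    then show "x \<in> {1..<m} \<union> {m<..m + d} \<union> {2 * m<..2 * m + d} \<union> (?I - S)"
      using x by (auto simp: I)
  qed
  then have "card (UNIV - S) \<le> card ({1..<m} \<union> {m<..m + d} \<union> {2 * m<..2 * m + d} \<union> (?I - S))"
    by (intro card_mono) auto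
  also have "\<dots> \<le> card {1..<m} + card {m<..m + d} + card {2 * m<..2 * m + d} + card (?I - S)"
    by (intro order.trans[OF card_Un_le] add_mono order.refl)
  finally show "genus S \<le> m - 1 + 2 * d + card (?I - S)" by (simp add: genus_def)
qed

end

lemma num_semigroupI: "numerical_semigroup S \<Longrightarrow> num_semigroup S"
  by unfold_locales

section \<open>Uniform subsets of prescribed size\<close>

lemma card_subsets_avoiding_containing:
  assumes "finite I" "A \<subseteq> I" "B \<subseteq> I" "A \<inter> B = {}"
  shows "card {G. G \<subseteq> I \<and> card G = j \<and> A \<inter> G = {} \<and> B \<subseteq> G}
    = (if card B \<le> j then (card I - card A - card B) choose (j - card B) else 0)"
proof (cases "card B \<le> j")
  case True
  have fin: "finite A" "finite B"
    using finite_subset[OF assms(2,1)] finite_subset[OF assms(3,1)] .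
  have "bij_betw (\<lambda>G. G - B) {G. G \<subseteq> I \<and> card G = j \<and> A \<inter> G = {} \<and> B \<subseteq> G}
     {H. H \<subseteq> I - A - B \<and> card H = j - card B}"
  proof (rule bij_betw_byWitness[where f' = "\<lambda>H. H \<union> B"])
    show "(\<lambda>G. G - B) ` {G. G \<subseteq> I \<and> card G = j \<and> A \<inter> G = {} \<and> B \<subseteq> G}
       \<subseteq> {H. H \<subseteq> I - A - B \<and> card H = j - card B}"
      using fin by (auto simp: card_Diff_subset)
    show "(\<lambda>H. H \<union> B) ` {H. H \<subseteq> I - A - B \<and> card H = j - card B}
       \<subseteq> {G. G \<subseteq> I \<and> card G = j \<and> A \<inter> G = {} \<and> B \<subseteq> G}"
    proof (rule image_subsetI)
      fix H assume H: "H \<in> {H. H \<subseteq> I - A - B \<and> card H = j - card B}"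
      then have "finite H" using assms(1) by (intro finite_subset[of H I]) auto
      moreover have "H \<inter> B = {}" using H by auto
      ultimately have "card (H \<union> B) = j" using H fin True by (simp add: card_Un_disjoint)
      then show "H \<union> B \<in> {G. G \<subseteq> I \<and> card G = j \<and> A \<inter> G = {} \<and> B \<subseteq> G}"
        using H assms by auto
    qed
  qed auto
  then have "card {G. G \<subseteq> I \<and> card G = j \<and> A \<inter> G = {} \<and> B \<subseteq> G} = card {H. H \<subseteq> I - A - B \<and> card H = j - card B}"
    by (rule bij_betw_same_card)
  also have "\<dots> = card (I - A - B) choose (j - card B)"
    by (rule n_subsets) (use assms in auto)
  also have "card (I - A - B) = card I - card A - card B"
  proof -
    have "B \<subseteq> I - A" using assms by auto
    then show ?thesis using assms fin by (simp add: card_Diff_subset)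
  qed
  finally show ?thesis using True by simp
next
  case False
  have e: "{G. G \<subseteq> I \<and> card G = j \<and> A \<inter> G = {} \<and> B \<subseteq> G} = {}"
    using False assms(1) card_mono finite_subset by blast
  show ?thesis unfolding e using False by simp
qed

text \<open>Treat one prescribed point at a time. Keeping it out of the \<open>j\<close>-subset
  multiplies the binomial coefficient by \<open>(N - j) / N\<close>, near \<open>tau\<close>;
  putting it in multiplies by \<open>j / N\<close>, near \<open>1 - tau\<close>. Each step costs at
  most \<open>kappa\<close> relative to the original coefficient, because the smaller coefficients
  are bounded by it. The hypothesis covers all sizes met on the way.\<close>

lemma binomial_thinning:
  fixes kappa :: real
  assumes "\<And>n i. N - (a + b) \<le> n \<Longrightarrow> n \<le> N \<Longrightarrow> j - (a + b) \<le> i \<Longrightarrow> i \<le> j \<Longrightarrow>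
      i \<le> n \<and> \<bar>real i - (1 - tau) * real n\<bar> \<le> kappa * real n"
    and "a + b < N" "a + b < j"
  shows "\<bar>real ((N - a - b) choose (j - b)) - tau ^ a * (1 - tau) ^ b * real (N choose j)\<bar>
    \<le> real (a + b) * kappa * real (N choose j)"
  using assms
proof (induction "a + b" arbitrary: a b N j)
  case (Suc l)
  have near: "j \<le> N" "\<bar>real j - (1 - tau) * real N\<bar> \<le> kappa * real N"
    using Suc.prems(1)[of N j] by auto
  have N: "0 < N" "0 < j" using Suc.prems by auto
  note hyps = Suc.hyps and prems = Suc.prems
  have kappa: "0 \<le> kappa" using near N by (smt (verit) mult_neg_pos of_nat_0_less_iff)
  have scale: "real N * \<bar>u - c * v\<bar> = \<bar>real N * u - c * real N * v\<bar>" for u c v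
  proof -
    have "real N * u - c * real N * v = real N * (u - c * v)" by (simp add: algebra_simps)
    then show ?thesis by (simp add: abs_mult)
  qed
  show ?case
  proof (cases a)
    case (Suc a')
    let ?X = "real ((N - 1) choose j)" and ?P = "tau ^ a' * (1 - tau) ^ b"
    have P: "0 \<le> ?P" "?P \<le> 1"
      using tau_pos tau_less_1 by (auto intro!: mult_le_one power_le_one)
    have eq: "real N * ?X = (real N - real j) * real (N choose j)"
      using binomial_absorb_comp[of N j] near(1) by (metis of_nat_diff of_nat_mult)
    have le: "?X \<le> real (N choose j)"
      using binomial_right_mono[of "N - 1" N j] by simp
    have IH: "\<bar>real ((N - 1 - a' - b) choose (j - b)) - ?P * ?X\<bar> \<le> real (a' + b) * kappa * ?X"
    proof (rule hyps(1))
      show "l = a' + b" using hyps(2) Suc by linarith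
      show "a' + b < N - 1" "a' + b < j" using prems(2,3) Suc by linarith+
      show "i \<le> n \<and> \<bar>real i - (1 - tau) * real n\<bar> \<le> kappa * real n"
        if "N - 1 - (a' + b) \<le> n" "n \<le> N - 1" "j - (a' + b) \<le> i" "i \<le> j" for n i
      proof (rule prems(1))
        show "N - (a + b) \<le> n" "n \<le> N" "j - (a + b) \<le> i" "i \<le> j" using that Suc by linarith+
      qed
    qed
    have "real N * \<bar>?X - tau * real (N choose j)\<bar> = \<bar>real N * ?X - tau * real N * real (N choose j)\<bar>"
      by (rule scale)
    also have "\<dots> = \<bar>((1 - tau) * real N - real j) * real (N choose j)\<bar>"
      unfolding eq by (simp add: algebra_simps)
    also have "\<dots> \<le> kappa * real N * real (N choose j)"
      using near(2) by (simp add: abs_mult abs_minus_commute mult_right_mono)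
    finally have "\<bar>?X - tau * real (N choose j)\<bar> \<le> kappa * real (N choose j)"
      using N by (simp add: mult.assoc mult.left_commute)
    then have "\<bar>?P * (?X - tau * real (N choose j))\<bar> \<le> 1 * (kappa * real (N choose j))"
      unfolding abs_mult using P by (intro mult_mono) auto
    moreover have "real (a' + b) * kappa * ?X \<le> real (a' + b) * kappa * real (N choose j)"
      using le kappa by (intro mult_left_mono) auto
    moreover have "?P * (?X - tau * real (N choose j)) = ?P * ?X - tau ^ a * (1 - tau) ^ b * real (N choose j)"
      unfolding Suc by (simp add: algebra_simps)
    moreover have "real (a + b) * kappa * real (N choose j)
        = real (a' + b) * kappa * real (N choose j) + kappa * real (N choose j)"
      unfolding Suc by (simp add: algebra_simps)
    moreover have "real ((N - a - b) choose (j - b)) = real ((N - 1 - a' - b) choose (j - b))"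
      unfolding Suc by simp
    ultimately show ?thesis using IH by (smt (verit, best))
  next
    case 0
    then obtain b' where b: "b = Suc b'" using Suc.hyps(2) by (cases b) auto
    let ?X = "real ((N - 1) choose (j - 1))" and ?P = "tau ^ a * (1 - tau) ^ b'"
    have P: "0 \<le> ?P" "?P \<le> 1"
      using tau_pos tau_less_1 by (auto intro!: mult_le_one power_le_one)
    have eq: "real N * ?X = real j * real (N choose j)"
      using times_binomial_minus1_eq[OF N(2), of N] by (metis of_nat_mult)
    have "real N * ?X \<le> real N * real (N choose j)"
      unfolding eq using near(1) by (intro mult_right_mono) auto
    then have le: "?X \<le> real (N choose j)" using N by simp
    have IH: "\<bar>real ((N - 1 - a - b') choose (j - 1 - b')) - ?P * ?X\<bar> \<le> real (a + b') * kappa * ?X"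
    proof (rule hyps(1))
      show "l = a + b'" using hyps(2) b by linarith
      show "a + b' < N - 1" "a + b' < j - 1" using prems(2,3) b by linarith+
      show "i \<le> n \<and> \<bar>real i - (1 - tau) * real n\<bar> \<le> kappa * real n"
        if "N - 1 - (a + b') \<le> n" "n \<le> N - 1" "j - 1 - (a + b') \<le> i" "i \<le> j - 1" for n i
      proof (rule prems(1))
        show "N - (a + b) \<le> n" "n \<le> N" "j - (a + b) \<le> i" "i \<le> j" using that b by linarith+
      qed
    qed
    have "real N * \<bar>?X - (1 - tau) * real (N choose j)\<bar> = \<bar>real N * ?X - (1 - tau) * real N * real (N choose j)\<bar>"
      by (rule scale)
    also have "\<dots> = \<bar>(real j - (1 - tau) * real N) * real (N choose j)\<bar>"
      unfolding eq by (simp add: algebra_simps)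
    also have "\<dots> \<le> kappa * real N * real (N choose j)"
      using near(2) by (simp add: abs_mult mult_right_mono)
    finally have "\<bar>?X - (1 - tau) * real (N choose j)\<bar> \<le> kappa * real (N choose j)"
      using N by (simp add: mult.assoc mult.left_commute)
    then have "\<bar>?P * (?X - (1 - tau) * real (N choose j))\<bar> \<le> 1 * (kappa * real (N choose j))"
      unfolding abs_mult using P by (intro mult_mono) auto
    moreover have "real (a + b') * kappa * ?X \<le> real (a + b') * kappa * real (N choose j)"
      using le kappa by (intro mult_left_mono) auto
    moreover have "?P * (?X - (1 - tau) * real (N choose j)) = ?P * ?X - tau ^ a * (1 - tau) ^ b * real (N choose j)"
      unfolding b by (simp add: algebra_simps)
    moreover have "real (a + b) * kappa * real (N choose j)
        = real (a + b') * kappa * real (N choose j) + kappa * real (N choose j)"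
      unfolding b by (simp add: algebra_simps)
    moreover have "real ((N - a - b) choose (j - b)) = real ((N - 1 - a - b') choose (j - 1 - b'))"
      unfolding b by simp
    ultimately show ?thesis using IH by (smt (verit, best))
  qed
qed simp

text \<open>A semigroup of the fibre is encoded by its gaps \<open>G\<close> in the interval; the
  genus fixes their number. Passing to gaps interchanges the roles: \<open>A\<close> must avoid
  \<open>G\<close> and \<open>B\<close> must lie in \<open>G\<close>.\<close>

lemma card_fiber:
  assumes S0: "numerical_semigroup S0" "genus S0 = g" "tail_from d S0" "d < semigroup_mult S0"
    and A: "A \<subseteq> free_interval d S0" and B: "B \<subseteq> free_interval d S0"
  shows "card {S \<in> semigroups_of_genus g. tail_from d S \<and> semigroup_mult S = semigroup_mult S0 \<and>
           S - free_interval d S = S0 - free_interval d S0 \<and> A \<subseteq> S \<and> B \<inter> S = {}}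
    = card {G. G \<subseteq> free_interval d S0 \<and> card G = card (free_interval d S0 - S0) \<and> A \<inter> G = {} \<and> B \<subseteq> G}"
proof -
  interpret num_semigroup S0 "semigroup_mult S0" using S0 by unfold_locales
  let ?I = "free_interval d S0"
  let ?L = "{S \<in> semigroups_of_genus g. tail_from d S \<and> semigroup_mult S = semigroup_mult S0 \<and>
           S - free_interval d S = S0 - ?I \<and> A \<subseteq> S \<and> B \<inter> S = {}}"
  let ?R = "{G. G \<subseteq> ?I \<and> card G = card (?I - S0) \<and> A \<inter> G = {} \<and> B \<subseteq> G}"
  have I: "free_interval d S = ?I" if "semigroup_mult S = semigroup_mult S0" for S
    using that by (simp add: free_interval_def)
  have refl: "(S0 - ?I) \<union> (S0 \<inter> ?I) = S0" by auto
  have g0: "g = card (UNIV - S0 - ?I) + card (?I - S0)"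
    using refill_free_interval(6)[OF S0(4,3), of "S0 \<inter> ?I"] S0(2) unfolding refl
    by (simp add: Diff_Int)
  have "bij_betw (\<lambda>S. ?I - S) ?L ?R"
  proof (rule bij_betw_byWitness[where f' = "\<lambda>G. (S0 - ?I) \<union> (?I - G)"])
    show "\<forall>S\<in>?L. (S0 - ?I) \<union> (?I - (?I - S)) = S"
    proof
      fix S assume "S \<in> ?L"
      then have "S - ?I = S0 - ?I" using I[of S] by auto
      then show "(S0 - ?I) \<union> (?I - (?I - S)) = S" by blast
    qed
    show "\<forall>G\<in>?R. ?I - ((S0 - ?I) \<union> (?I - G)) = G" by auto
    show "(\<lambda>S. ?I - S) ` ?L \<subseteq> ?R"
    proof (rule image_subsetI)
      fix S assume S: "S \<in> ?L"
      then have "S - ?I = S0 - ?I" using I[of S] by auto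
      then have e: "(S0 - ?I) \<union> (S \<inter> ?I) = S" by blast
      have "genus S = card (UNIV - S0 - ?I) + card (?I - S)"
        using refill_free_interval(6)[OF S0(4,3), of "S \<inter> ?I"] unfolding e by (simp add: Diff_Int)
      then have "card (?I - S) = card (?I - S0)"
        using S g0 by (simp add: semigroups_of_genus_def)
      then show "?I - S \<in> ?R" using S A B by auto
    qed
    show "(\<lambda>G. (S0 - ?I) \<union> (?I - G)) ` ?R \<subseteq> ?L"
    proof (rule image_subsetI)
      fix G assume G: "G \<in> ?R"
      note r = refill_free_interval[OF S0(4,3), of "?I - G"]
      have "?I - (?I - G) = G" using G by auto
      then have "genus ((S0 - ?I) \<union> (?I - G)) = g"
        using r(6) G g0 by simp
      then show "(S0 - ?I) \<union> (?I - G) \<in> ?L"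
        using r(1-4) I[OF r(2)] G A B by (auto simp: semigroups_of_genus_def)
    qed
  qed
  then show ?thesis by (rule bij_betw_same_card)
qed

lemma card_by_fibers:
  assumes "finite A"
  shows "real (card {a \<in> A. P a}) = (\<Sum>z\<in>h ` A. real (card {a \<in> A. h a = z \<and> P a}))"
proof -
  have "real (card {a \<in> A. P a}) = (\<Sum>a\<in>A. if P a then 1 else 0)"
    using assms by (simp add: sum.If_cases Int_def)
  also have "\<dots> = (\<Sum>z\<in>h ` A. \<Sum>a\<in>{a \<in> A. h a = z}. if P a then 1 else 0)"
    by (rule sum.image_gen[OF assms])
  also have "\<dots> = (\<Sum>z\<in>h ` A. real (card {a \<in> A. h a = z \<and> P a}))"
    using assms by (intro sum.cong refl) (simp add: sum.If_cases Int_def conj_assoc)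
  finally show ?thesis .
qed

text \<open>Partition \<open>X\<close> by multiplicity and by the part of S outside the interval.
  Each fibre is a full family of subsets of one size, so \<open>binomial_thinning\<close> holds with
  the same relative error on every fibre, and the errors add up.\<close>

lemma equidistribution_on_free_intervals:
  fixes kappa :: real and Q :: "nat \<Rightarrow> bool" and d g :: nat
  defines "X \<equiv> {S \<in> semigroups_of_genus g. tail_from d S \<and> Q (semigroup_mult S)}"
  assumes AB: "A \<inter> B = {}" "card A + card B = l"
    and X: "\<And>S. S \<in> X \<Longrightarrow> d < semigroup_mult S \<and> A \<subseteq> free_interval d S \<and> B \<subseteq> free_interval d S"
    and size: "\<And>S. S \<in> X \<Longrightarrow> l < card (free_interval d S) \<and> l < card (free_interval d S - S)"
    and near: "\<And>S n i. S \<in> X \<Longrightarrow> card (free_interval d S) - l \<le> n \<Longrightarrow> n \<le> card (free_interval d S) \<Longrightarrow>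
        card (free_interval d S - S) - l \<le> i \<Longrightarrow> i \<le> card (free_interval d S - S) \<Longrightarrow>
        i \<le> n \<and> \<bar>real i - (1 - tau) * real n\<bar> \<le> kappa * real n"
  shows "\<bar>real (card {S \<in> X. A \<subseteq> S \<and> B \<inter> S = {}}) - tau ^ card A * (1 - tau) ^ card B * real (card X)\<bar>
     \<le> real l * kappa * real (card X)"
proof -
  define h where "h = (\<lambda>S. (semigroup_mult S, S - free_interval d S))"
  define c where "c = (\<lambda>z. real (card {S \<in> X. h S = z \<and> True}))"
  define e where "e = (\<lambda>z. real (card {S \<in> X. h S = z \<and> (A \<subseteq> S \<and> B \<inter> S = {})}))"
  let ?p = "tau ^ card A * (1 - tau) ^ card B"
  have fin: "finite X" by (simp add: X_def)
  have sumX: "real (card X) = (\<Sum>z\<in>h ` X. c z)"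
    using card_by_fibers[OF fin, of "\<lambda>_. True" h] by (simp add: c_def)
  have sumE: "real (card {S \<in> X. A \<subseteq> S \<and> B \<inter> S = {}}) = (\<Sum>z\<in>h ` X. e z)"
    unfolding e_def by (rule card_by_fibers[OF fin])
  have fib: "\<bar>e z - ?p * c z\<bar> \<le> real l * kappa * c z" if z: "z \<in> h ` X" for z
  proof -
    obtain S0 where S0: "S0 \<in> X" "z = h S0" using z by auto
    then have s: "numerical_semigroup S0" "genus S0 = g" "tail_from d S0" "Q (semigroup_mult S0)"
      by (auto simp: X_def semigroups_of_genus_def)
    define I where "I = free_interval d S0"
    define j where "j = card (I - S0)"
    have x: "d < semigroup_mult S0" "A \<subseteq> I" "B \<subseteq> I" using X[OF S0(1)] by (auto simp: I_def)
    have eq: "{S \<in> X. h S = z \<and> A' \<subseteq> S \<and> B' \<inter> S = {}} = {S \<in> semigroups_of_genus g. tail_from d S \<and>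
        semigroup_mult S = semigroup_mult S0 \<and> S - free_interval d S = S0 - free_interval d S0 \<and> A' \<subseteq> S \<and> B' \<inter> S = {}}" for A' B'
      using s(4) S0(2) by (auto simp: X_def h_def)
    have count: "card {S \<in> X. h S = z \<and> A' \<subseteq> S \<and> B' \<inter> S = {}} =
        card {G. G \<subseteq> I \<and> card G = j \<and> A' \<inter> G = {} \<and> B' \<subseteq> G}" if "A' \<subseteq> I" "B' \<subseteq> I" for A' B'
      unfolding eq I_def j_def by (rule card_fiber) (use s x that I_def in auto)
    have fI: "finite I" by (simp add: I_def)
    \<comment> \<open>The size of the whole fibre is the case of empty prescriptions.\<close>
    have "c z = real (card I choose j)"
      using count[of "{}" "{}"] n_subsets[OF fI, of j] by (simp add: c_def)
    moreover have "card B \<le> j" using size[OF S0(1)] AB(2) unfolding I_def[symmetric] j_def by linarith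
    then have "e z = real ((card I - card A - card B) choose (j - card B))"
      using count[OF x(2,3)] card_subsets_avoiding_containing[OF fI x(2,3) AB(1), of j] by (simp add: e_def)
    moreover have "\<bar>real ((card I - card A - card B) choose (j - card B)) - ?p * real (card I choose j)\<bar>
        \<le> real (card A + card B) * kappa * real (card I choose j)"
    proof (rule binomial_thinning)
      show "card A + card B < card I" "card A + card B < j"
        using size[OF S0(1)] unfolding AB(2) I_def j_def by blast+
      show "i \<le> n \<and> \<bar>real i - (1 - tau) * real n\<bar> \<le> kappa * real n"
        if "card I - (card A + card B) \<le> n" "n \<le> card I" "j - (card A + card B) \<le> i" "i \<le> j" for n i
        using near[OF S0(1)] that unfolding AB(2) I_def j_def by blast
    qed
    ultimately show ?thesis using AB(2) by simp
  qed
  have "\<bar>(\<Sum>z\<in>h ` X. e z) - ?p * (\<Sum>z\<in>h ` X. c z)\<bar> = \<bar>\<Sum>z\<in>h ` X. e z - ?p * c z\<bar>"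
    by (simp add: sum_subtractf sum_distrib_left)
  also have "\<dots> \<le> (\<Sum>z\<in>h ` X. real l * kappa * c z)"
    by (rule order.trans[OF sum_abs]) (intro sum_mono fib)
  also have "\<dots> = real l * kappa * (\<Sum>z\<in>h ` X. c z)"
    by (simp add: sum_distrib_left)
  finally show ?thesis unfolding sumX sumE .
qed

section \<open>Exponential bounds for the number of semigroups\<close>

text \<open>A Chernoff bound with free parameter \<open>x\<close>. S is determined by its part in
  two windows of length \<open>d\<close>, which gives 4^d, and by its gaps \<open>G\<close> in the
  interval. Since m - 1 + |G| is at most g and x < 1, \<open>x ^ g\<close> is at most
  \<open>x ^ (m - 1) * x ^ card G\<close>; the sum over \<open>G\<close> is a binomial
  expansion.\<close>

lemma card_fixed_mult_le:
  fixes x :: real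
  assumes x: "0 < x" "x < 1"
  shows "real (card {S \<in> semigroups_of_genus g. tail_from d S \<and> semigroup_mult S = m}) * x ^ g
     \<le> 4 ^ d * (x + x ^ 2) ^ (m - 1)"
proof -
  define I where "I = {m + d<..<2 * m}"
  define Y where "Y = {S \<in> semigroups_of_genus g. tail_from d S \<and> semigroup_mult S = m}"
  define h where "h = (\<lambda>S. (S \<inter> {m<..m + d}, S \<inter> {2 * m<..2 * m + d}, I - S))"
  define T where "T = Pow {m<..m + d} \<times> Pow {2 * m<..2 * m + d} \<times> Pow I"
  define f where "f = (\<lambda>(P :: nat set, Q :: nat set, G :: nat set). x ^ (m - 1) * x ^ card G)"
  have finI: "finite I" by (simp add: I_def)
  have Y: "num_semigroup S" "genus S = g" "tail_from d S" "semigroup_mult S = m" "I = free_interval d S"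
    if "S \<in> Y" for S
    using that by (auto simp: Y_def semigroups_of_genus_def num_semigroupI free_interval_def I_def)
  have mem: "y \<in> S \<longleftrightarrow> y = 0 \<or> y = m \<or> y = 2 * m \<or> 2 * m + d < y \<or>
      y \<in> S \<inter> {m<..m + d} \<or> y \<in> S \<inter> {2 * m<..2 * m + d} \<or> (y \<in> I \<and> y \<notin> I - S)" if S: "S \<in> Y" for S y
  proof -
    note n = num_semigroup.zero_mem[OF Y(1)[OF S]] num_semigroup.mult_mem[OF Y(1)[OF S]]
      num_semigroup.add_mem[OF Y(1)[OF S]] num_semigroup.mem_ge_mult[OF Y(1)[OF S]]
    have "2 * m \<in> S" using n(3)[OF n(2) n(2)] Y(4)[OF S] by (simp add: mult_2)
    moreover have "y \<in> S" if "2 * m + d < y" using Y(3,4)[OF S] that by (simp add: tail_from_def)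
    moreover have "y = 0 \<or> m \<le> y" if "y \<in> S" using n(4)[OF that] Y(4)[OF S] by simp
    ultimately show ?thesis using n(1,2) Y(4)[OF S] by (auto simp: I_def)
  qed
  have "real (card Y) * x ^ g = (\<Sum>S\<in>Y. x ^ g)" by simp
  also have "\<dots> \<le> (\<Sum>z\<in>T. f z)"
  proof (rule sum_le_sum_inj_on[of h])
    show "inj_on h Y"
    proof (rule inj_onI)
      fix S S' assume S: "S \<in> Y" "S' \<in> Y" and e: "h S = h S'"
      have e': "S \<inter> {m<..m + d} = S' \<inter> {m<..m + d}"
        "S \<inter> {2 * m<..2 * m + d} = S' \<inter> {2 * m<..2 * m + d}" "I - S = I - S'"
        using e by (auto simp: h_def)
      have "y \<in> S \<longleftrightarrow> y \<in> S'" for y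
        unfolding mem[OF S(1), of y] mem[OF S(2), of y] e' ..
      then show "S = S'" by blast
    qed
    show "h ` Y \<subseteq> T" by (auto simp: h_def T_def)
    show "finite T" by (simp add: T_def finI)
    show "0 \<le> f z" for z using x by (auto simp: f_def case_prod_unfold)
    show "x ^ g \<le> f (h S)" if S: "S \<in> Y" for S
    proof -
      have "m - 1 + card (I - S) \<le> g"
        using num_semigroup.genus_free_interval(1)[OF Y(1)[OF S] Y(3)[OF S]] Y[OF S] by simp
      then show ?thesis using x by (simp add: f_def h_def power_add[symmetric] power_decreasing)
    qed
  qed
  also have "\<dots> = 2 ^ d * (2 ^ d * (x ^ (m - 1) * (\<Sum>G\<in>Pow I. x ^ card G)))"
    unfolding T_def f_def by (simp add: sum.cartesian_product[symmetric] sum_distrib_left card_Pow)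
  also have "(\<Sum>G\<in>Pow I. x ^ card G) = (1 + x) ^ card I"
    using prod_add[OF finI, of "\<lambda>_. x" "\<lambda>_. 1"] by (simp add: add.commute)
  also have "2 ^ d * (2 ^ d * (x ^ (m - 1) * (1 + x) ^ card I)) \<le> 2 ^ d * (2 ^ d * (x ^ (m - 1) * (1 + x) ^ (m - 1)))"
    using x by (intro mult_left_mono power_increasing) (auto simp: I_def)
  also have "\<dots> = (2 * 2) ^ d * (x * (1 + x)) ^ (m - 1)"
    by (simp only: power_mult_distrib mult_ac)
  also have "\<dots> = 4 ^ d * (x + x ^ 2) ^ (m - 1)"
    by (simp add: algebra_simps power2_eq_square)
  finally show ?thesis unfolding Y_def .
qed

text \<open>For m = g - k + 1 start from {0} together with all numbers from m on, which has g - k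
  gaps, and remove any k of the g - k numbers strictly between m and 2m. The binomial coefficients
  along this diagonal sum to a Fibonacci number.\<close>

lemma fib_le_card_semigroups: "fib (Suc g) \<le> card (semigroups_of_genus g)"
proof -
  define M where "M = (\<lambda>k. g - k + 1)"
  define I where "I = (\<lambda>k. {M k<..<2 * M k})"
  define S0 where "S0 = (\<lambda>k. insert 0 {M k..})"
  define h where "h = (\<lambda>(k, G). (S0 k - I k) \<union> (I k - G))"
  define D where "D = (SIGMA k:{0..g}. {G. G \<subseteq> I k \<and> card G = k})"
  have base: "num_semigroup (S0 k)" "semigroup_mult (S0 k) = M k" "tail_from 0 (S0 k)"
     "free_interval 0 (S0 k) = I k" "card (UNIV - S0 k - I k) = g - k" for k
  proof -
    have gaps: "UNIV - S0 k = {1..<M k}" by (auto simp: S0_def)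
    show "num_semigroup (S0 k)"
      by (rule num_semigroupI) (auto simp: numerical_semigroup_def gaps, auto simp: S0_def)
    show m: "semigroup_mult (S0 k) = M k"
      by (rule semigroup_mult_eqI) (auto simp: S0_def M_def)
    show "tail_from 0 (S0 k)" unfolding tail_from_def m by (auto simp: S0_def)
    show "free_interval 0 (S0 k) = I k" by (simp add: free_interval_def m I_def)
    have "UNIV - S0 k - I k = {1..<M k}" unfolding gaps by (auto simp: I_def)
    then show "card (UNIV - S0 k - I k) = g - k" by (simp add: M_def)
  qed
  have r: "numerical_semigroup (h (k, G))" "semigroup_mult (h (k, G)) = M k" "genus (h (k, G)) = g"
     "I k - h (k, G) = G" if "(k, G) \<in> D" for k G
  proof -
    have G: "k \<le> g" "G \<subseteq> I k" "card G = k" using that by (auto simp: D_def)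
    note r = num_semigroup.refill_free_interval[OF base(1), of 0 k "I k - G", unfolded base(2,4)]
    have M: "0 < M k" by (simp add: M_def)
    have "I k - (I k - G) = G" using G by auto
    then show "numerical_semigroup (h (k, G))" "semigroup_mult (h (k, G)) = M k"
      "genus (h (k, G)) = g" "I k - h (k, G) = G"
      using r(1,2,6)[OF M base(3)] base(5)[of k] G by (auto simp: h_def)
  qed
  have inj: "inj_on h D"
  proof (rule inj_onI, clarify)
    fix k G k' G' assume a: "(k, G) \<in> D" "(k', G') \<in> D" and e: "h (k, G) = h (k', G')"
    have "M k = M k'" using r(2)[OF a(1)] r(2)[OF a(2)] e by simp
    moreover have "k \<le> g" "k' \<le> g" using a by (auto simp: D_def)
    ultimately have "k = k'" by (simp add: M_def)
    then show "k = k' \<and> G = G'" using r(4)[OF a(1)] r(4)[OF a(2)] e by metis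
  qed
  have "fib (Suc g) = (\<Sum>k = 0..g. (g - k) choose k)" by (rule ne_diagonal_fib[symmetric])
  also have "\<dots> = (\<Sum>k\<in>{0..g}. card {G. G \<subseteq> I k \<and> card G = k})"
  proof (intro sum.cong refl)
    fix k
    have "2 * (a + 1) - Suc (a + 1) = a" for a by simp
    then have "card (I k) = g - k" unfolding I_def M_def card_greaterThanLessThan .
    then show "(g - k) choose k = card {G. G \<subseteq> I k \<and> card G = k}"
      by (subst n_subsets) (auto simp: I_def)
  qed
  also have "\<dots> = card D" unfolding D_def by (rule card_SigmaI[symmetric]) (auto simp: I_def)
  also have "\<dots> = card (h ` D)" using inj by (simp add: card_image)
  also have "\<dots> \<le> card (semigroups_of_genus g)"
  proof (rule card_mono)
    show "h ` D \<subseteq> semigroups_of_genus g" using r by (auto simp: semigroups_of_genus_def)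
  qed simp
  finally show ?thesis .
qed

lemma card_semigroups_lower_bound: "tau \<le> real (card (semigroups_of_genus g)) * tau ^ g"
proof -
  have "tau \<le> real (fib (Suc g)) * tau ^ g"
  proof (induction g rule: fib.induct)
    case (3 n)
    have "real (fib (Suc (Suc (Suc n)))) * tau ^ Suc (Suc n)
      = tau * (real (fib (Suc (Suc n))) * tau ^ Suc n) + tau ^ 2 * (real (fib (Suc n)) * tau ^ n)"
      by (simp add: algebra_simps power2_eq_square)
    also have "\<dots> \<ge> tau * tau + tau ^ 2 * tau"
      using 3 tau_pos by (intro add_mono mult_left_mono) auto
    also have "tau * tau + tau ^ 2 * tau = tau * (tau + tau ^ 2)" by (simp add: algebra_simps)
    finally show ?case by (simp add: tau_sq)
  qed (use tau_pos tau_less_1 in auto)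
  also have "\<dots> \<le> real (card (semigroups_of_genus g)) * tau ^ g"
    using fib_le_card_semigroups tau_pos by (intro mult_right_mono) auto
  finally show ?thesis .
qed

section \<open>Concentration of the multiplicity\<close>

text \<open>The origin of gamma: with m - 1 gaps below m and gap density 1 - tau between m and 2m,
  the genus is about (2 - tau) m. The last identity is the vanishing of the derivative in
  \<open>DERIV_log_tilt\<close> for \<open>c = gamma\<close>.\<close>

lemma gamma_bounds: "0.7 < gamma" "gamma < 0.73"
  and gamma_tau: "gamma * (2 - tau) = 1" "gamma * (1 + 2 * tau) = 1 + tau"
proof -
  show "0.7 < gamma" "gamma < 0.73" using tau_bounds by (auto simp: gamma_def tau_def)
  have "sqrt 5 * sqrt 5 = 5" by simp
  then show "gamma * (2 - tau) = 1" "gamma * (1 + 2 * tau) = 1 + tau"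
    by (auto simp: gamma_def tau_def field_simps)
qed

lemma tau_inverse: "1 / tau = 1 + tau"
  using tau_sq tau_pos by (simp add: field_simps power2_eq_square)

text \<open>gamma is the value of c for which the derivative at tau vanishes.\<close>

lemma DERIV_log_tilt:
  "((\<lambda>x. c * ln (x + x ^ 2) - ln x) has_real_derivative (c * (1 + 2 * tau) - (1 + tau))) (at tau)"
proof -
  have "((\<lambda>x. c * ln (x + x ^ 2) - ln x) has_real_derivative
      (c * ((1 + 2 * tau) / (tau + tau ^ 2)) - 1 / tau)) (at tau)"
    using tau_pos tau_sq by (auto intro!: derivative_eq_intros simp: field_simps)
  then show ?thesis by (simp add: tau_sq tau_inverse)
qed

text \<open>The value at tau is \<open>- ln tau\<close>, since tau + tau^2 = 1, and the derivative
  is negative, so a small step to the right gains. There x + x^2 > 1, so the resulting bound also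
  serves all smaller m.\<close>

lemma exists_tilt_above:
  assumes "0 < e"
  obtains x where "tau < x" "x < 1" "(gamma - e) * ln (x + x ^ 2) - ln x < - ln tau"
proof -
  define f where "f = (\<lambda>x. (gamma - e) * ln (x + x ^ 2) - ln x)"
  have "(f has_real_derivative (- e * (1 + 2 * tau))) (at tau)"
  proof -
    have "(gamma - e) * (1 + 2 * tau) - (1 + tau) = - e * (1 + 2 * tau)"
      using gamma_tau(2) by (simp add: algebra_simps)
    then show ?thesis using DERIV_log_tilt[of "gamma - e"] unfolding f_def by simp
  qed
  moreover have "- e * (1 + 2 * tau) < 0" using assms tau_pos by (simp add: mult_pos_pos)
  ultimately obtain d where d: "0 < d" "\<And>h. 0 < h \<Longrightarrow> h < d \<Longrightarrow> f (tau + h) < f tau"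
    using DERIV_neg_dec_right by blast
  obtain h where h: "0 < h" "h < d" "tau + h < 1"
    using dense[of 0 "min d (1 - tau)"] d(1) tau_less_1 by (auto simp: algebra_simps)
  have "f tau = - ln tau" by (simp add: f_def tau_sq)
  then have "f (tau + h) < - ln tau" using d(2)[OF h(1,2)] by simp
  then show ?thesis using that[of "tau + h"] h unfolding f_def by simp
qed

text \<open>The mirror image: here x + x^2 < 1, so the bound also serves all larger m.\<close>

lemma exists_tilt_below:
  assumes "0 < e"
  obtains x where "0 < x" "x < tau" "(gamma + e) * ln (x + x ^ 2) - ln x < - ln tau"
proof -
  define f where "f = (\<lambda>x. (gamma + e) * ln (x + x ^ 2) - ln x)"
  have "(f has_real_derivative (e * (1 + 2 * tau))) (at tau)"
  proof -
    have "(gamma + e) * (1 + 2 * tau) - (1 + tau) = e * (1 + 2 * tau)"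
      using gamma_tau(2) by (simp add: algebra_simps)
    then show ?thesis using DERIV_log_tilt[of "gamma + e"] unfolding f_def by simp
  qed
  moreover have "0 < e * (1 + 2 * tau)" using assms tau_pos by (simp add: mult_pos_pos)
  ultimately obtain d where d: "0 < d" "\<And>h. 0 < h \<Longrightarrow> h < d \<Longrightarrow> f (tau - h) < f tau"
    using DERIV_pos_inc_left by blast
  obtain h where h: "0 < h" "h < d" "h < tau"
    using dense[of 0 "min d tau"] d(1) tau_pos by auto
  have "f tau = - ln tau" by (simp add: f_def tau_sq)
  then have "f (tau - h) < - ln tau" using d(2)[OF h(1,2)] by simp
  then show ?thesis using that[of "tau - h"] h unfolding f_def by simp
qed

lemma power_le_exp_mult:
  fixes z :: real
  assumes "0 < z" "real n * ln z \<le> b"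
  shows "z ^ n \<le> exp b"
proof -
  have "z ^ n = exp (real n * ln z)" using assms(1) by (simp add: exp_of_nat_mult)
  then show ?thesis using assms(2) by simp
qed

text \<open>One tilt handles all m below the range and one all m above it. The constant
  \<open>K\<close> compensates for the exponent \<open>m - 1\<close> when the base
  \<open>w + w ^ 2\<close> is below 1. As \<open>c\<close> does not depend on \<open>d\<close>, a
  small multiple of g can later be chosen for \<open>d\<close>.\<close>

lemma card_off_centre:
  assumes e: "0 < e"
  obtains c K where "0 < c" "c < 1" "0 < K"
    "\<forall>g d m. e * real g < \<bar>real m - gamma * real g\<bar> \<longrightarrow> 1 \<le> m \<longrightarrow>
      real (card {S \<in> semigroups_of_genus g. tail_from d S \<and> semigroup_mult S = m}) * tau ^ g
        \<le> K * 4 ^ d * c ^ g"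
proof -
  obtain x where x: "tau < x" "x < 1" "(gamma - e) * ln (x + x ^ 2) - ln x < - ln tau"
    using exists_tilt_above[OF e] .
  obtain w where w: "0 < w" "w < tau" "(gamma + e) * ln (w + w ^ 2) - ln w < - ln tau"
    using exists_tilt_below[OF e] .
  define c1 where "c1 = (gamma - e) * ln (x + x ^ 2) - ln x + ln tau"
  define c2 where "c2 = (gamma + e) * ln (w + w ^ 2) - ln w + ln tau"
  define c where "c = exp (max c1 c2)"
  define K where "K = max 1 (1 / (w + w ^ 2))"
  have x0: "0 < x" using x(1) tau_pos by simp
  have x1: "1 < x + x ^ 2"
  proof -
    have "tau ^ 2 < x ^ 2" using x(1) tau_pos by (intro power_strict_mono) auto
    then show ?thesis using x(1) tau_sq by simp
  qed
  have w1: "w + w ^ 2 < 1" "0 < w + w ^ 2"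
  proof -
    have "w ^ 2 < tau ^ 2" using w(1,2) by (intro power_strict_mono) auto
    then show "w + w ^ 2 < 1" using w(2) tau_sq by simp
    show "0 < w + w ^ 2" using w(1) by (simp add: add_pos_pos)
  qed
  have K: "1 \<le> K" "1 / (w + w ^ 2) \<le> K" by (auto simp: K_def)
  have main: "real (card {S \<in> semigroups_of_genus g. tail_from d S \<and> semigroup_mult S = m}) * tau ^ g
        \<le> K * 4 ^ d * c ^ g" if m: "e * real g < \<bar>real m - gamma * real g\<bar>" "1 \<le> m" for g d m
  proof -
    let ?n = "real (card {S \<in> semigroups_of_genus g. tail_from d S \<and> semigroup_mult S = m})"
    have transfer: "?n * tau ^ g \<le> K * 4 ^ d * c ^ g"
      if z: "0 < z" "z < 1" and le: "(z + z ^ 2) ^ (m - 1) * (tau / z) ^ g \<le> K * c ^ g" for z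
    proof -
      have "?n * tau ^ g = (?n * z ^ g) * (tau / z) ^ g"
        using z by (simp add: power_divide)
      also have "\<dots> \<le> (4 ^ d * (z + z ^ 2) ^ (m - 1)) * (tau / z) ^ g"
        using z tau_pos by (intro mult_right_mono card_fixed_mult_le) auto
      also have "\<dots> = 4 ^ d * ((z + z ^ 2) ^ (m - 1) * (tau / z) ^ g)" by simp
      also have "\<dots> \<le> 4 ^ d * (K * c ^ g)" using le by (intro mult_left_mono) auto
      finally show ?thesis by (simp add: mult_ac)
    qed
    have cg: "c ^ g = exp (real g * max c1 c2)" by (simp add: c_def exp_of_nat_mult)
    have tz: "(tau / z) ^ g = exp (real g * (ln tau - ln z))" if "0 < z" for z
      using tau_pos that by (simp add: exp_of_nat_mult exp_diff ln_div power_divide)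
    show ?thesis
    proof (cases "real m < gamma * real g")
      case True
      then have "real m \<le> (gamma - e) * real g" using m by (simp add: algebra_simps)
      then have "real (m - 1) \<le> (gamma - e) * real g" by linarith
      then have "real (m - 1) * ln (x + x ^ 2) \<le> (gamma - e) * real g * ln (x + x ^ 2)"
        using x1 by (intro mult_right_mono) auto
      then have "(x + x ^ 2) ^ (m - 1) \<le> exp ((gamma - e) * real g * ln (x + x ^ 2))"
        using x1 by (intro power_le_exp_mult) auto
      then have "(x + x ^ 2) ^ (m - 1) * (tau / x) ^ g
          \<le> exp ((gamma - e) * real g * ln (x + x ^ 2)) * exp (real g * (ln tau - ln x))"
        unfolding tz[OF x0] by (intro mult_right_mono) auto
      also have "\<dots> = exp (real g * c1)"
        unfolding exp_add[symmetric] by (simp add: c1_def algebra_simps)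
      also have "\<dots> \<le> c ^ g" unfolding cg by (simp add: mult_left_mono)
      also have "\<dots> \<le> K * c ^ g" using K(1) by (simp add: c_def)
      finally show ?thesis using transfer[OF x0 x(2)] by blast
    next
      case False
      then have "(gamma + e) * real g \<le> real m" using m by (simp add: algebra_simps)
      then have "real m * ln (w + w ^ 2) \<le> (gamma + e) * real g * ln (w + w ^ 2)"
        using w1 by (intro mult_right_mono_neg) auto
      then have le: "(w + w ^ 2) ^ m \<le> exp ((gamma + e) * real g * ln (w + w ^ 2))"
        using w1 by (intro power_le_exp_mult) auto
      have "(w + w ^ 2) ^ (m - 1) = (w + w ^ 2) ^ m * (1 / (w + w ^ 2))"
        using m(2) w1 by (cases m) auto
      also have "\<dots> \<le> exp ((gamma + e) * real g * ln (w + w ^ 2)) * K"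
        using le K(2) w1 by (intro mult_mono) auto
      finally have "(w + w ^ 2) ^ (m - 1) * (tau / w) ^ g
          \<le> exp ((gamma + e) * real g * ln (w + w ^ 2)) * K * exp (real g * (ln tau - ln w))"
        unfolding tz[OF w(1)] by (intro mult_right_mono) auto
      also have "\<dots> = K * (exp ((gamma + e) * real g * ln (w + w ^ 2)) * exp (real g * (ln tau - ln w)))"
        by (simp only: mult_ac)
      also have "exp ((gamma + e) * real g * ln (w + w ^ 2)) * exp (real g * (ln tau - ln w)) = exp (real g * c2)"
        unfolding exp_add[symmetric] by (simp add: c2_def algebra_simps)
      also have "K * exp (real g * c2) \<le> K * c ^ g"
        unfolding cg using K(1) by (intro mult_left_mono) (auto simp: mult_left_mono)
      finally show ?thesis using transfer[OF w(1)] w(2) tau_less_1 by simp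
    qed
  qed
  show ?thesis
  proof (rule that[of c K])
    show "c < 1" using x(3) w(3) by (simp add: c_def c1_def c2_def)
  qed (use K main in \<open>auto simp: c_def\<close>)
qed

section \<open>The limit\<close>

text \<open>With \<open>q = s ^ 4\<close> each of the four linear factors receives its own
  \<open>s ^ g\<close>.\<close>

lemma poly_times_geometric_tendsto_0:
  fixes q :: real
  assumes "0 < q" "q < 1"
  shows "(\<lambda>g. real (g + 2) ^ 4 * q ^ g) \<longlonglongrightarrow> 0"
proof -
  define s where "s = sqrt (sqrt q)"
  have s: "0 < s" "s < 1" using assms by (auto simp: s_def)
  have s4: "s ^ 4 = q"
  proof -
    have "s ^ 4 = (s ^ 2) ^ 2" by (simp flip: power_mult)
    then show ?thesis using assms by (simp add: s_def)
  qed
  have "(\<lambda>g. real g * s ^ g + 2 * s ^ g) \<longlonglongrightarrow> 0 + 2 * 0"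
    using s by (intro tendsto_intros powser_times_n_limit_0 LIMSEQ_power_zero) auto
  then have "(\<lambda>g. (real g * s ^ g + 2 * s ^ g) ^ 4) \<longlonglongrightarrow> 0 ^ 4"
    by (intro tendsto_power) simp
  moreover have "(real g * s ^ g + 2 * s ^ g) ^ 4 = real (g + 2) ^ 4 * q ^ g" for g
  proof -
    have "real g * s ^ g + 2 * s ^ g = real (g + 2) * s ^ g" by (simp add: algebra_simps)
    then show ?thesis
      by (simp only: power_mult_distrib s4[symmetric] power_mult[symmetric] mult.commute)
  qed
  ultimately show ?thesis by simp
qed

lemma not_tail_from:
  assumes "S \<in> semigroups_of_genus g" "1 \<le> g" "\<not> tail_from d S"
  shows "2 * semigroup_mult S + d < frobenius S"
proof -
  have S: "numerical_semigroup S" "genus S = g" using assms(1) by (auto simp: semigroups_of_genus_def)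
  obtain x where x: "2 * semigroup_mult S + d < x" "x \<notin> S" using assms(3) by (auto simp: tail_from_def)
  have "x \<le> frobenius S"
    unfolding frobenius_def using x S(1) by (intro Max_ge) (auto simp: numerical_semigroup_def)
  then show ?thesis using x(1) by simp
qed

lemma card_atypical:
  fixes d :: nat
  assumes "1 \<le> g" "5 * d \<le> g" "0 \<le> D"
    and off: "\<And>m. 1 \<le> m \<Longrightarrow> e * real g < \<bar>real m - gamma * real g\<bar> \<Longrightarrow>
      real (card {S \<in> semigroups_of_genus g. tail_from d S \<and> semigroup_mult S = m}) * tau ^ g \<le> D"
  shows "real (card {S \<in> semigroups_of_genus g.
      \<not> (tail_from d S \<and> \<bar>real (semigroup_mult S) - gamma * real g\<bar> \<le> e * real g)}) * tau ^ g
    \<le> real (g + 2) ^ 4 * (4 * 0.998 ^ d + D)"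
proof -
  define Bad where "Bad = {S \<in> semigroups_of_genus g. 2 * semigroup_mult S + d < frobenius S}"
  define Y where "Y = (\<lambda>m. {S \<in> semigroups_of_genus g. tail_from d S \<and> semigroup_mult S = m})"
  define M where "M = {m \<in> {1..g + 1}. e * real g < \<bar>real m - gamma * real g\<bar>}"
  let ?R = "{S \<in> semigroups_of_genus g.
      \<not> (tail_from d S \<and> \<bar>real (semigroup_mult S) - gamma * real g\<bar> \<le> e * real g)}"
  have sub: "?R \<subseteq> Bad \<union> (\<Union>m\<in>M. Y m)"
  proof
    fix S assume S: "S \<in> ?R"
    show "S \<in> Bad \<union> (\<Union>m\<in>M. Y m)"
    proof (cases "tail_from d S")
      case False
      then show ?thesis using S not_tail_from[of S g d] assms(1) by (auto simp: Bad_def)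
    next
      case True
      have "num_semigroup S" "genus S = g" using S by (auto simp: semigroups_of_genus_def num_semigroupI)
      then have "0 < semigroup_mult S" "semigroup_mult S \<le> g + 1"
        using num_semigroup.mult_pos num_semigroup.mult_le_genus by blast+
      then have "semigroup_mult S \<in> M" using S True by (auto simp: M_def)
      then show ?thesis using S True by (auto simp: Y_def)
    qed
  qed
  have "card ?R \<le> card (Bad \<union> (\<Union>m\<in>M. Y m))"
    by (rule card_mono[OF _ sub]) (auto simp: Bad_def Y_def M_def)
  also have "\<dots> \<le> card Bad + (\<Sum>m\<in>M. card (Y m))"
    by (rule order.trans[OF card_Un_le], rule add_left_mono, rule card_UN_le) (simp add: M_def)
  finally have "real (card ?R) \<le> real (card Bad) + (\<Sum>m\<in>M. real (card (Y m)))"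
    unfolding of_nat_sum[symmetric] of_nat_add[symmetric] by (rule of_nat_mono)
  then have "real (card ?R) * tau ^ g \<le> (real (card Bad) + (\<Sum>m\<in>M. real (card (Y m)))) * tau ^ g"
    using tau_pos by (intro mult_right_mono) auto
  also have "\<dots> = real (card Bad) * tau ^ g + (\<Sum>m\<in>M. real (card (Y m)) * tau ^ g)"
    by (simp add: distrib_right sum_distrib_right)
  also have "\<dots> \<le> 4 * real (g + 2) ^ 4 * 0.998 ^ d + (\<Sum>m\<in>M. D)"
    unfolding Bad_def Y_def using off
    by (intro add_mono sum_mono card_large_frobenius assms) (auto simp: M_def)
  also have "(\<Sum>m\<in>M. D) \<le> real (g + 2) ^ 4 * D"
  proof -
    have "card M \<le> card {1..g + 1}" by (rule card_mono) (auto simp: M_def)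
    then have "card M \<le> (g + 2) ^ 1" by simp
    also have "\<dots> \<le> (g + 2) ^ 4" by (rule power_increasing) auto
    finally have "real (card M) \<le> real (g + 2) ^ 4" by (metis of_nat_le_iff of_nat_power)
    then show ?thesis using assms(3) by (simp add: mult_right_mono)
  qed
  finally show ?thesis by (simp add: algebra_simps)
qed

lemma atypical_negligible:
  assumes "0 < e" "0 < eta0"
  obtains eta where "0 < eta" "eta \<le> eta0"
    "(\<lambda>g. real (card {S \<in> semigroups_of_genus g. \<not> (tail_from (nat \<lfloor>eta * real g\<rfloor>) S \<and>
        \<bar>real (semigroup_mult S) - gamma * real g\<bar> \<le> e * real g)})
      / real (card (semigroups_of_genus g))) \<longlonglongrightarrow> 0"
proof -
  obtain c K where c: "0 < c" "c < 1" "0 < K"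
    and off: "\<forall>g d m. e * real g < \<bar>real m - gamma * real g\<bar> \<longrightarrow> 1 \<le> m \<longrightarrow>
      real (card {S \<in> semigroups_of_genus g. tail_from d S \<and> semigroup_mult S = m}) * tau ^ g
        \<le> K * 4 ^ d * c ^ g"
    by (rule card_off_centre[OF assms(1)])
  \<comment> \<open>\<open>eta < - ln c / ln 4\<close> means \<open>4 powr eta * c < 1\<close>, so
    the windows cost less than is gained away from gamma; \<open>eta < 1 / 5\<close> gives
    \<open>5 * d g \<le> g\<close>.\<close>
  have "0 < - ln c / ln 4" using c by (simp add: divide_neg_pos)
  then have "0 < min (min eta0 (1 / 5)) (- ln c / ln 4)" using assms(2) by simp
  from dense[OF this] obtain eta where eta: "0 < eta" "eta < eta0" "eta < 1 / 5" "eta < - ln c / ln 4"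
    by (metis min_less_iff_conj)
  define q1 where "q1 = 4 powr eta * c"
  define q2 where "q2 = (0.998::real) powr eta"
  define d where "d = (\<lambda>g. nat \<lfloor>eta * real g\<rfloor>)"
  define R where "R = (\<lambda>g. real (card {S \<in> semigroups_of_genus g. \<not> (tail_from (d g) S \<and>
        \<bar>real (semigroup_mult S) - gamma * real g\<bar> \<le> e * real g)}))"
  define n where "n = (\<lambda>g. real (card (semigroups_of_genus g)))"
  have q1: "0 < q1" "q1 < 1"
  proof -
    show "0 < q1" using c by (simp add: q1_def)
    have "eta * ln 4 < - ln c" by (rule iffD1[OF pos_less_divide_eq eta(4)]) simp
    then have "ln q1 < 0" using c by (simp add: q1_def ln_mult ln_powr)
    then show "q1 < 1" using \<open>0 < q1\<close> by simp
  qed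
  have q2: "0 < q2" "q2 < 1"
  proof -
    show "0 < q2" by (simp add: q2_def)
    have "ln q2 < 0" using eta by (simp add: q2_def ln_powr mult_pos_neg)
    then show "q2 < 1" using \<open>0 < q2\<close> by simp
  qed
  have dle: "real (d g) \<le> eta * real g" "eta * real g - 1 \<le> real (d g)" for g
  proof -
    have "0 \<le> eta * real g" using eta(1) by simp
    then have "real (d g) = real_of_int \<lfloor>eta * real g\<rfloor>" by (simp add: d_def)
    then show "real (d g) \<le> eta * real g" "eta * real g - 1 \<le> real (d g)" by linarith+
  qed
  have four: "4 ^ d g * c ^ g \<le> q1 ^ g" for g
  proof -
    have "(4::real) ^ d g = 4 powr real (d g)" by (simp add: powr_realpow)
    also have "\<dots> \<le> 4 powr (eta * real g)" using dle by (intro powr_mono) auto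
    also have "\<dots> = (4 powr eta) ^ g" by (simp add: powr_powr[symmetric] powr_realpow)
    finally show ?thesis unfolding q1_def power_mult_distrib using c by (intro mult_right_mono) auto
  qed
  have small: "0.998 ^ d g \<le> q2 ^ g / 0.998" for g
  proof -
    have "(0.998::real) ^ d g = 0.998 powr real (d g)" by (simp add: powr_realpow)
    also have "\<dots> \<le> 0.998 powr (eta * real g - 1)" using dle by (intro powr_mono') auto
    also have "\<dots> = (0.998 powr eta) ^ g / 0.998" by (simp add: powr_diff powr_powr[symmetric] powr_realpow)
    finally show ?thesis by (simp add: q2_def)
  qed
  have bound: "R g / n g \<le> (5 / tau) * (real (g + 2) ^ 4 * q2 ^ g) + (K / tau) * (real (g + 2) ^ 4 * q1 ^ g)"
    if g: "1 \<le> g" for g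
  proof -
    have "5 * real (d g) \<le> real g"
    proof -
      have "eta * real g \<le> 1 / 5 * real g" using eta by (intro mult_right_mono) auto
      then show ?thesis using dle(1)[of g] by linarith
    qed
    then have d5: "5 * d g \<le> g" by linarith
    have "R g * tau ^ g \<le> real (g + 2) ^ 4 * (4 * 0.998 ^ d g + K * 4 ^ d g * c ^ g)"
      unfolding R_def by (rule card_atypical[OF g d5]) (use c off in auto)
    also have "\<dots> \<le> real (g + 2) ^ 4 * (5 * q2 ^ g + K * q1 ^ g)"
    proof (intro mult_left_mono add_mono)
      have "4 * (q2 ^ g / 0.998) \<le> 5 * q2 ^ g" using q2 by simp
      then show "4 * 0.998 ^ d g \<le> 5 * q2 ^ g" using small[of g] by linarith
      show "K * 4 ^ d g * c ^ g \<le> K * q1 ^ g"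
        using mult_left_mono[OF four[of g], of K] c by (simp add: mult_ac)
    qed auto
    finally have R: "R g * tau ^ g \<le> real (g + 2) ^ 4 * (5 * q2 ^ g + K * q1 ^ g)" .
    have n: "tau \<le> n g * tau ^ g" unfolding n_def by (rule card_semigroups_lower_bound)
    have "R g / n g = (R g * tau ^ g) / (n g * tau ^ g)" using tau_pos by simp
    also have "\<dots> \<le> (real (g + 2) ^ 4 * (5 * q2 ^ g + K * q1 ^ g)) / tau"
      using R n tau_pos q1 q2 c by (intro frac_le) (auto simp: R_def intro!: mult_nonneg_nonneg add_nonneg_nonneg)
    also have "\<dots> = (5 / tau) * (real (g + 2) ^ 4 * q2 ^ g) + (K / tau) * (real (g + 2) ^ 4 * q1 ^ g)"
      by (simp add: distrib_left add_divide_distrib mult.left_commute)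
    finally show ?thesis .
  qed
  have "(\<lambda>g. (5 / tau) * (real (g + 2) ^ 4 * q2 ^ g) + (K / tau) * (real (g + 2) ^ 4 * q1 ^ g))
      \<longlonglongrightarrow> (5 / tau) * 0 + (K / tau) * 0"
    by (intro tendsto_intros poly_times_geometric_tendsto_0 q1 q2)
  then have lim: "(\<lambda>g. (5 / tau) * (real (g + 2) ^ 4 * q2 ^ g) + (K / tau) * (real (g + 2) ^ 4 * q1 ^ g))
      \<longlonglongrightarrow> 0" by simp
  have "(\<lambda>g. R g / n g) \<longlonglongrightarrow> 0"
  proof (rule tendsto_sandwich[OF _ _ tendsto_const lim])
    show "\<forall>\<^sub>F g in sequentially. 0 \<le> R g / n g" by (simp add: R_def n_def)
    show "\<forall>\<^sub>F g in sequentially. R g / n g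
        \<le> (5 / tau) * (real (g + 2) ^ 4 * q2 ^ g) + (K / tau) * (real (g + 2) ^ 4 * q1 ^ g)"
      using eventually_ge_at_top[of 1] by eventually_elim (rule bound)
  qed
  then show ?thesis using that[of eta] eta unfolding R_def n_def d_def by simp
qed

text \<open>By \<open>gamma * (2 - tau) = 1\<close>, the gaps in the interval, about g - m, make up
  a proportion 1 - tau of its length, about m. In units of \<open>kappa * g\<close> the errors are
  0.14 from the multiplicity, 0.1 from \<open>3 * d\<close> and 0.1 from \<open>2 * l + 2\<close>;
  their sum is below 0.4, and \<open>n\<close> is at least 0.4 g.\<close>

lemma typical_sizes:
  fixes kappa e eta :: real and d g l :: nat
  assumes S: "S \<in> semigroups_of_genus g" "tail_from d S"
    and m: "\<bar>real (semigroup_mult S) - gamma * real g\<bar> \<le> e * real g"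
    and d: "real d \<le> eta * real g"
    and kappa: "0 < kappa" "kappa \<le> 1" "e \<le> kappa / 10" "eta \<le> kappa / 30"
    and l: "2 * real l + 2 \<le> kappa * real g / 10"
  shows "d < semigroup_mult S" "l < card (free_interval d S)" "l < card (free_interval d S - S)"
    and "card (free_interval d S) - l \<le> n \<Longrightarrow> n \<le> card (free_interval d S) \<Longrightarrow>
        card (free_interval d S - S) - l \<le> i \<Longrightarrow> i \<le> card (free_interval d S - S) \<Longrightarrow>
        i \<le> n \<and> \<bar>real i - (1 - tau) * real n\<bar> \<le> kappa * real n"
proof -
  define M where "M = semigroup_mult S"
  define j where "j = card (free_interval d S - S)"
  have ns: "num_semigroup S" "genus S = g" using S(1) by (auto simp: semigroups_of_genus_def num_semigroupI)
  have g1: "M - 1 + j \<le> g" "g \<le> M - 1 + 2 * d + j" "0 < M"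
    using num_semigroup.genus_free_interval[OF ns(1) S(2)] num_semigroup.mult_pos[OF ns(1)] ns(2)
    by (auto simp: M_def j_def)
  then have j: "real j \<le> real g - real M + 1" "real g - real M + 1 - 2 * real d \<le> real j" by linarith+
  have kg: "kappa * real g \<le> real g" using mult_right_mono[OF kappa(2), of "real g"] by simp
  have eg: "e * real g \<le> kappa * real g / 10" using mult_right_mono[OF kappa(3), of "real g"] by simp
  have dg: "real d \<le> kappa * real g / 30" using mult_right_mono[OF kappa(4), of "real g"] d by simp
  have gg: "0.7 * real g \<le> gamma * real g" "gamma * real g \<le> 73 / 100 * real g"
    using gamma_bounds by (intro mult_right_mono; simp)+
  have M: "0.6 * real g \<le> real M" "real M \<le> 83 / 100 * real g" using m eg kg gg unfolding M_def[symmetric] by linarith+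
  have g20: "20 \<le> real g" using l kg by linarith
  have "real d < real M" using dg kg M g20 by linarith
  then show dM: "d < semigroup_mult S" by (simp add: M_def)
  have N: "card (free_interval d S) = M - 1 - d" by (simp add: card_free_interval M_def)
  have "real l < real M - 1 - real d" using dg kg M g20 l by linarith
  then show "l < card (free_interval d S)" unfolding N by linarith
  have "real l < real j" using dg kg M j g20 l by linarith
  then show lj: "l < card (free_interval d S - S)" by (simp add: j_def)
  show "i \<le> n \<and> \<bar>real i - (1 - tau) * real n\<bar> \<le> kappa * real n"
    if "card (free_interval d S) - l \<le> n" "n \<le> card (free_interval d S)"
      "card (free_interval d S - S) - l \<le> i" "i \<le> card (free_interval d S - S)"
  proof -
    have n: "real M - 1 - real d - real l \<le> real n" "real n \<le> real M"
      using that(1,2) unfolding N by linarith+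
    have i: "real j - real l \<le> real i" "real i \<le> real j"
      using that(3,4) unfolding j_def[symmetric] by linarith+
    have n0: "0.4 * real g \<le> real n" using n dg kg M g20 l by linarith
    have "real i \<le> real n" using i j n dg kg M g20 l by linarith
    moreover have "\<bar>real i - (1 - tau) * real n\<bar> \<le> kappa * real n"
    proof -
      have "(2 - tau) * (gamma * real g - real M) = gamma * (2 - tau) * real g - (2 - tau) * real M"
        by (simp add: algebra_simps)
      then have "real g - (2 - tau) * real M = (2 - tau) * (gamma * real g - real M)"
        unfolding gamma_tau(1) by simp
      then have "\<bar>real g - (2 - tau) * real M\<bar> = (2 - tau) * \<bar>gamma * real g - real M\<bar>"
        using tau_less_1 by (simp add: abs_mult)
      also have "\<dots> \<le> 1.4 * (kappa * real g / 10)"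
        using tau_bounds m eg unfolding M_def[symmetric] by (intro mult_mono) (auto simp: abs_minus_commute)
      finally have 1: "\<bar>real g - (2 - tau) * real M\<bar> \<le> 1.4 * (kappa * real g / 10)" .
      have "(1 - tau) * (real M - real n) \<le> 1 * (real M - real n)"
        using tau_pos n(2) by (intro mult_right_mono) linarith+
      moreover have "0 \<le> (1 - tau) * (real M - real n)"
        using tau_less_1 n(2) by (intro mult_nonneg_nonneg) linarith+
      ultimately have 2: "(1 - tau) * (real M - real n) \<le> real M - real n" "0 \<le> (1 - tau) * (real M - real n)"
        by simp_all
      have "(2 - tau) * real M = real M + (1 - tau) * real n + (1 - tau) * (real M - real n)"
        by (simp add: algebra_simps)
      then have "\<bar>real i - (1 - tau) * real n\<bar> \<le> 1.4 * (kappa * real g / 10) + 3 * real d + 2 * real l + 2"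
        using 1 2 n i j by linarith
      also have "\<dots> \<le> kappa * (0.4 * real g)" using dg l by linarith
      also have "\<dots> \<le> kappa * real n" using n0 kappa by (intro mult_left_mono) auto
      finally show ?thesis .
    qed
    ultimately show ?thesis by simp
  qed
qed

section \<open>Prescribed positions\<close>

lemma admissible_cases:
  assumes "z \<in> admissible e g" "0 < e"
  obtains "1 \<le> z" "real z < (gamma - e) * real g" "real z < gamma * real g"
  | "(gamma + e) * real g < real z" "real z < (2 * gamma - e) * real g"
    "gamma * real g \<le> real z" "real z < 2 * gamma * real g"
  | "(2 * gamma + e) * real g < real z" "2 * gamma * real g \<le> real z"
proof -
  have "0 \<le> e * real g" using assms(2) by simp
  then have "(gamma - e) * real g \<le> gamma * real g" "gamma * real g \<le> (gamma + e) * real g"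
    "(2 * gamma - e) * real g \<le> 2 * gamma * real g" "2 * gamma * real g \<le> (2 * gamma + e) * real g"
    by (simp_all add: algebra_simps)
  then show ?thesis using assms(1) that unfolding admissible_def by force
qed

lemma f1_scaled:
  assumes "1 \<le> g"
  shows "f1 (real z / real g) =
    (if real z < gamma * real g then 0 else if real z < 2 * gamma * real g then tau else 1)"
  using assms by (simp add: f1_def tau_def divide_less_eq)

lemma prod_f1:
  assumes "finite C" "1 \<le> g" "\<And>z. z \<in> C \<Longrightarrow> gamma * real g \<le> real z"
  shows "(\<Prod>z\<in>C. f1 (real z / real g)) = tau ^ card {z \<in> C. real z < 2 * gamma * real g}"
proof -
  have "(\<Prod>z\<in>C. f1 (real z / real g)) = (\<Prod>z\<in>C. if real z < 2 * gamma * real g then tau else 1)"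
    using assms(3) by (intro prod.cong refl) (force simp: f1_scaled[OF assms(2)])
  then show ?thesis using assms(1) by (simp add: prod.If_cases Int_def)
qed

lemma prod_one_minus_f1:
  assumes "finite C" "1 \<le> g" "\<And>z. z \<in> C \<Longrightarrow> real z < 2 * gamma * real g"
  shows "(\<Prod>z\<in>C. 1 - f1 (real z / real g)) = (1 - tau) ^ card {z \<in> C. gamma * real g \<le> real z}"
proof -
  have "(\<Prod>z\<in>C. 1 - f1 (real z / real g)) = (\<Prod>z\<in>C. if gamma * real g \<le> real z then 1 - tau else 1)"
    using assms(3) by (intro prod.cong refl) (force simp: f1_scaled[OF assms(2)])
  then show ?thesis using assms(1) by (simp add: prod.If_cases Int_def)
qed

text \<open>With quarter margins, m, m + d, 2m and 2m + d deviate from gamma g or 2 gamma g by at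
  most 3/4 of \<open>e * g\<close>, so an admissible position is always on the intended
  side.\<close>

lemma typical_positions:
  assumes S: "S \<in> semigroups_of_genus g" "tail_from d S"
    and m: "\<bar>real (semigroup_mult S) - gamma * real g\<bar> \<le> e' * real g"
    and d: "real d \<le> eta * real g"
    and e: "0 < e" "e' \<le> e / 4" "eta \<le> e / 4"
    and z: "z \<in> admissible e g"
  shows "real z < gamma * real g \<Longrightarrow> z \<notin> S"
    and "gamma * real g \<le> real z \<Longrightarrow> real z < 2 * gamma * real g \<Longrightarrow> z \<in> free_interval d S"
    and "2 * gamma * real g \<le> real z \<Longrightarrow> z \<in> S"
proof -
  have ns: "num_semigroup S" using S(1) by (auto simp: semigroups_of_genus_def num_semigroupI)
  define M where "M = real (semigroup_mult S)"
  define G where "G = gamma * real g"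
  define E where "E = e * real g"
  have E: "0 \<le> E" using e(1) by (simp add: E_def)
  have "e' * real g \<le> e / 4 * real g" "eta * real g \<le> e / 4 * real g"
    by (rule mult_right_mono[OF e(2)], simp, rule mult_right_mono[OF e(3)], simp)
  then have b: "\<bar>M - G\<bar> \<le> E / 4" "real d \<le> E / 4" using m d by (auto simp: M_def G_def E_def)
  have low: "(gamma - e) * real g = G - E" "(gamma + e) * real g = G + E"
    "(2 * gamma - e) * real g = 2 * G - E" "(2 * gamma + e) * real g = 2 * G + E"
    "2 * gamma * real g = 2 * G"
    by (simp_all add: G_def E_def algebra_simps)
  have G: "0 \<le> G" using gamma_bounds by (simp add: G_def)
  note c = admissible_cases[OF z e(1), unfolded low G_def[symmetric]]
  show "z \<notin> S" if "real z < gamma * real g"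
  proof -
    have l: "real z < G" using that by (simp add: G_def)
    have "1 \<le> z \<and> real z < G - E" by (rule c) (use l E G in auto)
    then have "0 < z" "real z < M" using b E by (simp, linarith)
    then show ?thesis using num_semigroup.less_mult_not_mem[OF ns] by (simp add: M_def)
  qed
  show "z \<in> free_interval d S" if "gamma * real g \<le> real z" "real z < 2 * gamma * real g"
  proof -
    have l: "G \<le> real z" "real z < 2 * G" using that unfolding low by (auto simp: G_def)
    have "G + E < real z \<and> real z < 2 * G - E" by (rule c) (use l E G in auto)
    then have "M + real d < real z" "real z < 2 * M" using b E by linarith+
    then show ?thesis unfolding free_interval_def M_def by auto
  qed
  show "z \<in> S" if "2 * gamma * real g \<le> real z"
  proof -
    have l: "2 * G \<le> real z" using that unfolding low .
    have "2 * G + E < real z" by (rule c) (use l E G in auto)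
    then have "2 * M + real d < real z" using b E by linarith
    then have "2 * semigroup_mult S + d < z" unfolding M_def by linarith
    then show ?thesis using S(2) by (simp add: tail_from_def)
  qed
qed

theorem theorem6p1:
  fixes l1 l2 :: nat and \<epsilon>1 \<epsilon>2 :: real
  assumes "\<epsilon>1 > 0" and "\<epsilon>2 > 0"
  shows "\<exists>M>0. \<forall>g::nat. real g > M \<longrightarrow>
           (\<forall>C C'. C \<subseteq> admissible \<epsilon>1 g \<and> C' \<subseteq> admissible \<epsilon>1 g \<and>
              card C = l1 \<and> card C' = l2 \<and> finite C \<and> finite C' \<and> C \<inter> C' = {} \<longrightarrow>
              \<bar>prob_g g (\<lambda>S. C \<subseteq> S \<and> C' \<inter> S = {})
                 - (\<Prod>n\<in>C. f1 (real n / real g)) * (\<Prod>n\<in>C'. 1 - f1 (real n / real g))\<bar> < \<epsilon>2)"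
proof -
  define l where "l = l1 + l2"
  \<comment> \<open>Each of the \<open>l\<close> prescribed positions costs a relative error
    \<open>kappa\<close>; together they may use a quarter of \<epsilon>2. Writing
    \<open>l + 1\<close> covers \<open>l = 0\<close>.\<close>
  define kappa where "kappa = min 1 (\<epsilon>2 / (4 * real (l + 1)))"
  define e where "e = min (kappa / 10) (\<epsilon>1 / 4)"
  have kappa: "0 < kappa" "kappa \<le> 1" "kappa \<le> \<epsilon>2 / (4 * real (l + 1))"
    using assms(2) by (auto simp: kappa_def)
  have lk: "real l * kappa \<le> \<epsilon>2 / 4"
  proof -
    have cancel: "x * (\<epsilon>2 / (4 * x)) = \<epsilon>2 / 4" if "0 < x" for x
      using that by (simp add: field_simps)
    have "real l * kappa \<le> real (l + 1) * (\<epsilon>2 / (4 * real (l + 1)))"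
      using kappa by (intro mult_mono) auto
    also have "\<dots> = \<epsilon>2 / 4" by (rule cancel) simp
    finally show ?thesis .
  qed
  have e: "0 < e" "e \<le> kappa / 10" "e \<le> \<epsilon>1 / 4" using kappa assms by (auto simp: e_def)
  define eta0 where "eta0 = min (kappa / 30) (\<epsilon>1 / 4)"
  have eta0: "0 < eta0" using kappa assms by (simp add: eta0_def)
  obtain eta where eta: "0 < eta" "eta \<le> eta0"
    and lim: "(\<lambda>g. real (card {S \<in> semigroups_of_genus g. \<not> (tail_from (nat \<lfloor>eta * real g\<rfloor>) S \<and>
        \<bar>real (semigroup_mult S) - gamma * real g\<bar> \<le> e * real g)})
      / real (card (semigroups_of_genus g))) \<longlonglongrightarrow> 0"
    by (rule atypical_negligible[OF e(1) eta0])
  have eta': "eta \<le> kappa / 30" "eta \<le> \<epsilon>1 / 4" using eta by (auto simp: eta0_def)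
  from order_tendstoD(2)[OF lim, of "\<epsilon>2 / 4"] assms(2) obtain N where
    N: "\<And>g. N \<le> g \<Longrightarrow> real (card {S \<in> semigroups_of_genus g. \<not> (tail_from (nat \<lfloor>eta * real g\<rfloor>) S \<and>
        \<bar>real (semigroup_mult S) - gamma * real g\<bar> \<le> e * real g)})
      / real (card (semigroups_of_genus g)) < \<epsilon>2 / 4"
    unfolding eventually_sequentially by auto
  define M where "M = real N + 1 + 10 * (2 * real l + 2) / kappa"
  have "0 < M" using kappa by (simp add: M_def add_pos_nonneg)
  moreover have "\<bar>prob_g g (\<lambda>S. C \<subseteq> S \<and> C' \<inter> S = {})
      - (\<Prod>n\<in>C. f1 (real n / real g)) * (\<Prod>n\<in>C'. 1 - f1 (real n / real g))\<bar> < \<epsilon>2"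
    if g: "M < real g" and C: "C \<subseteq> admissible \<epsilon>1 g" "C' \<subseteq> admissible \<epsilon>1 g"
      "card C = l1" "card C' = l2" "finite C" "finite C'" "C \<inter> C' = {}" for g C C'
  proof -
    have "0 \<le> 10 * (2 * real l + 2) / kappa" using kappa by simp
    then have gN: "N \<le> g" "1 \<le> g" "10 * (2 * real l + 2) / kappa < real g"
      using g unfolding M_def by linarith+
    then have lg: "2 * real l + 2 \<le> kappa * real g / 10"
      using kappa(1) by (simp add: divide_less_eq mult.commute)
    define d where "d = nat \<lfloor>eta * real g\<rfloor>"
    define Q where "Q = (\<lambda>m. \<bar>real m - gamma * real g\<bar> \<le> e * real g)"
    define X where "X = {S \<in> semigroups_of_genus g. tail_from d S \<and> Q (semigroup_mult S)}"
    define R where "R = {S \<in> semigroups_of_genus g. \<not> (tail_from d S \<and> Q (semigroup_mult S))}"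
    define P where "P = {S \<in> semigroups_of_genus g. C \<subseteq> S \<and> C' \<inter> S = {}}"
    define n where "n = real (card (semigroups_of_genus g))"
    define f where "f = (\<Prod>n\<in>C. f1 (real n / real g)) * (\<Prod>n\<in>C'. 1 - f1 (real n / real g))"
    have d: "real d \<le> eta * real g" using eta(1) by (simp add: d_def)
    have fin: "finite X" "finite R" "finite P" by (simp_all add: X_def R_def P_def)
    have npos: "0 < n"
    proof (rule ccontr)
      assume "\<not> 0 < n"
      then have "n = 0" by (simp add: n_def)
      then show False using card_semigroups_lower_bound[of g] tau_pos unfolding n_def[symmetric] by simp
    qed
    have R: "real (card R) < \<epsilon>2 / 4 * n"
      using N[OF gN(1)] npos unfolding R_def Q_def d_def n_def by (simp add: divide_less_eq)
    have nXR: "n = real (card X) + real (card R)"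
    proof -
      have "semigroups_of_genus g = X \<union> R" "X \<inter> R = {}" by (auto simp: X_def R_def)
      then show ?thesis unfolding n_def using fin by (simp add: card_Un_disjoint)
    qed
    have PR: "real (card P) \<le> real (card (P \<inter> X)) + real (card R)" "card (P \<inter> X) \<le> card P"
    proof -
      have "P \<subseteq> (P \<inter> X) \<union> R" by (auto simp: P_def X_def R_def)
      then have "card P \<le> card ((P \<inter> X) \<union> R)" using fin by (intro card_mono) auto
      also have "\<dots> \<le> card (P \<inter> X) + card R" by (rule card_Un_le)
      finally show "real (card P) \<le> real (card (P \<inter> X)) + real (card R)" by simp
      show "card (P \<inter> X) \<le> card P" using fin by (intro card_mono) auto
    qed
    have pos: "(real z < gamma * real g \<longrightarrow> z \<notin> S) \<and>
        (gamma * real g \<le> real z \<and> real z < 2 * gamma * real g \<longrightarrow> z \<in> free_interval d S) \<and>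
        (2 * gamma * real g \<le> real z \<longrightarrow> z \<in> S)" if "S \<in> X" "z \<in> admissible \<epsilon>1 g" for S z
    proof -
      have S: "S \<in> semigroups_of_genus g" "tail_from d S"
        "\<bar>real (semigroup_mult S) - gamma * real g\<bar> \<le> e * real g"
        using that(1) unfolding X_def Q_def by blast+
      show ?thesis
        using typical_positions[OF S d assms(1) e(3) eta'(2) that(2)] by blast
    qed
    have main: "\<bar>real (card (P \<inter> X)) - f * real (card X)\<bar> \<le> \<epsilon>2 / 4 * real (card X) \<and> 0 \<le> f \<and> f \<le> 1"
    \<comment> \<open>In the first case no typical semigroup meets the condition, and some factor of
      the product is 0.\<close>
    proof (cases "(\<exists>z\<in>C. real z < gamma * real g) \<or> (\<exists>z\<in>C'. 2 * gamma * real g \<le> real z)")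
      case True
      have "S \<notin> P" if S: "S \<in> X" for S
      proof
        assume "S \<in> P"
        then have "C \<subseteq> S" "C' \<inter> S = {}" by (auto simp: P_def)
        then show False using True pos[OF S] C(1,2) by blast
      qed
      then have "P \<inter> X = {}" by blast
      moreover have "f = 0"
      proof -
        have "gamma * real g \<le> 2 * gamma * real g" using gamma_bounds by simp
        then have "f1 (real z / real g) = 1" if "2 * gamma * real g \<le> real z" for z
          using that unfolding f1_scaled[OF gN(2)] by simp
        moreover have "f1 (real z / real g) = 0" if "real z < gamma * real g" for z
          using that unfolding f1_scaled[OF gN(2)] by simp
        ultimately have "(\<exists>z\<in>C. f1 (real z / real g) = 0) \<or> (\<exists>z\<in>C'. 1 - f1 (real z / real g) = 0)"
          using True by (metis diff_self)
        then show ?thesis using C(5,6) unfolding f_def by (metis mult_eq_0_iff prod_zero_iff)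
      qed
      ultimately show ?thesis using assms(2) by simp
    next
      case False
      \<comment> \<open>Only the middle zone is random. The remaining points of \<open>C\<close> lie
        beyond 2 gamma g and those of \<open>C'\<close> below gamma g, where every S in
        \<open>X\<close> behaves as required.\<close>
      define A where "A = {z \<in> C. real z < 2 * gamma * real g}"
      define B where "B = {z \<in> C'. gamma * real g \<le> real z}"
      define l' where "l' = card A + card B"
      have AB: "A \<subseteq> C" "B \<subseteq> C'" by (auto simp: A_def B_def)
      have l': "l' \<le> l"
        unfolding l'_def l_def using card_mono[OF C(5) AB(1)] card_mono[OF C(6) AB(2)] C(3,4) by simp
      have f: "f = tau ^ card A * (1 - tau) ^ card B"
        unfolding f_def A_def B_def
        using False prod_f1[OF C(5) gN(2)] prod_one_minus_f1[OF C(6) gN(2)] by (simp add: not_less not_le)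
      have PX: "P \<inter> X = {S \<in> X. A \<subseteq> S \<and> B \<inter> S = {}}"
      proof (intro equalityI subsetI)
        fix S assume "S \<in> P \<inter> X"
        then show "S \<in> {S \<in> X. A \<subseteq> S \<and> B \<inter> S = {}}" using AB by (auto simp: P_def)
      next
        fix S assume S: "S \<in> {S \<in> X. A \<subseteq> S \<and> B \<inter> S = {}}"
        have "C \<subseteq> S"
        proof
          fix z assume z: "z \<in> C"
          show "z \<in> S"
            using S z pos[of S z] C(1) by (cases "real z < 2 * gamma * real g") (auto simp: A_def)
        qed
        moreover have "z \<notin> S" if z: "z \<in> C'" for z
          using S z pos[of S z] C(2) by (cases "gamma * real g \<le> real z") (auto simp: B_def)
        ultimately show "S \<in> P \<inter> X" using S by (auto simp: P_def X_def)
      qed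
      have lg': "2 * real l' + 2 \<le> kappa * real g / 10" using lg l' by linarith
      have sizes: "d < semigroup_mult S" "l' < card (free_interval d S)" "l' < card (free_interval d S - S)"
        "\<And>n i. card (free_interval d S) - l' \<le> n \<Longrightarrow> n \<le> card (free_interval d S) \<Longrightarrow>
        card (free_interval d S - S) - l' \<le> i \<Longrightarrow> i \<le> card (free_interval d S - S) \<Longrightarrow>
        i \<le> n \<and> \<bar>real i - (1 - tau) * real n\<bar> \<le> kappa * real n" if "S \<in> X" for S
      proof -
        have S: "S \<in> semigroups_of_genus g" "tail_from d S"
          "\<bar>real (semigroup_mult S) - gamma * real g\<bar> \<le> e * real g"
          using that by (auto simp: X_def Q_def)
        note t = typical_sizes[OF S d kappa(1,2) e(2) eta'(1) lg']
        show "d < semigroup_mult S" "l' < card (free_interval d S)" "l' < card (free_interval d S - S)"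
          by (fact t)+
        show "i \<le> n \<and> \<bar>real i - (1 - tau) * real n\<bar> \<le> kappa * real n"
          if "card (free_interval d S) - l' \<le> n" "n \<le> card (free_interval d S)"
            "card (free_interval d S - S) - l' \<le> i" "i \<le> card (free_interval d S - S)" for n i
          using t(4)[OF that] .
      qed
      have "\<bar>real (card {S \<in> X. A \<subseteq> S \<and> B \<inter> S = {}}) - tau ^ card A * (1 - tau) ^ card B * real (card X)\<bar>
          \<le> real l' * kappa * real (card X)"
        unfolding X_def
      proof (rule equidistribution_on_free_intervals, unfold X_def[symmetric])
        show "A \<inter> B = {}" using AB C(7) by auto
        show "card A + card B = l'" by (simp add: l'_def)
        fix S assume S: "S \<in> X"
        have "A \<subseteq> free_interval d S" "B \<subseteq> free_interval d S"
          using pos[OF S] C(1,2) False by (auto simp: A_def B_def not_less not_le subset_iff)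
        then show "d < semigroup_mult S \<and> A \<subseteq> free_interval d S \<and> B \<subseteq> free_interval d S"
          using sizes(1)[OF S] by blast
        show "l' < card (free_interval d S) \<and> l' < card (free_interval d S - S)"
          using sizes(2,3)[OF S] by blast
        show "i \<le> n \<and> \<bar>real i - (1 - tau) * real n\<bar> \<le> kappa * real n"
          if "card (free_interval d S) - l' \<le> n" "n \<le> card (free_interval d S)"
            "card (free_interval d S - S) - l' \<le> i" "i \<le> card (free_interval d S - S)" for n i
          using sizes(4)[OF S that] .
      qed
      also have "\<dots> \<le> \<epsilon>2 / 4 * real (card X)"
      proof (rule mult_right_mono)
        have "real l' * kappa \<le> real l * kappa" using l' kappa by (intro mult_right_mono) auto
        then show "real l' * kappa \<le> \<epsilon>2 / 4" using lk by linarith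
      qed simp
      finally have "\<bar>real (card (P \<inter> X)) - f * real (card X)\<bar> \<le> \<epsilon>2 / 4 * real (card X)"
        unfolding PX f .
      moreover have "0 \<le> f" "f \<le> 1"
        unfolding f using tau_pos tau_less_1 by (auto intro!: mult_le_one power_le_one)
      ultimately show ?thesis by blast
    qed
    have fR: "0 \<le> f * real (card R)" "f * real (card R) \<le> real (card R)"
      using main by (auto intro: mult_left_le_one_le)
    have eX: "\<epsilon>2 / 4 * real (card X) \<le> \<epsilon>2 / 4 * n"
      unfolding nXR using assms(2) by (intro mult_left_mono) auto
    have "f * n = f * real (card X) + f * real (card R)" unfolding nXR by (simp add: distrib_left)
    moreover have "real (card (P \<inter> X)) \<le> real (card P)" using PR(2) by simp
    \<comment> \<open>One quarter for the error on \<open>X\<close>, and one each for the atypical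
      semigroups in \<open>P\<close> and in \<open>f * n\<close>.\<close>
    ultimately have "\<bar>real (card P) - f * n\<bar> \<le> 3 * (\<epsilon>2 / 4 * n)"
      using main fR eX PR(1) R by (smt (verit, best))
    also have "\<dots> < \<epsilon>2 * n" using assms(2) npos by simp
    finally have "\<bar>real (card P) - f * n\<bar> / n < \<epsilon>2" using npos by (simp add: divide_less_eq)
    moreover have "\<bar>real (card P) - f * n\<bar> / n = \<bar>real (card P) / n - f\<bar>"
    proof -
      have "real (card P) / n - f = (real (card P) - f * n) / n" using npos by (simp add: diff_divide_distrib)
      then show ?thesis using npos by (simp add: abs_divide)
    qed
    ultimately show ?thesis by (simp add: prob_g_def P_def n_def f_def)
  qed
  ultimately show ?thesis by blast
qed

end
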